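(* Let $X$ be a Banach space, let $\varphi: X \to (-\infty,\infty]$ be a proper lower semicontinuous function, let $\bar{x} \in \operatorname{dom}\varphi$, and let $\bar{x}^* \in \partial\varphi(\bar{x})$, where $\partial$ denotes the limiting subdifferential. Consider the assertions: (i) $\varphi$ is variationally convex at $\bar{x}$ for $\bar{x}^*$; (ii) there exist a convex neighborhood $U \times V$ of $(\bar{x},\bar{x}^* )$ in $X \times X^*$ and $\varepsilon>0$ such that for every $(u,u^* ) \in (U_\varepsilon \times V)\cap \operatorname{gph}\partial\varphi$ one has $\varphi(x) \ge \varphi(u) + \langle u^*, x-u\rangle$ for all $x \in U$, where $U_\varepsilon := \{x \in U : \varphi(x) < \varphi(\bar{x}) + \varepsilon\}$. Then (i) implies (ii) in every Banach space $X$. Conversely, (ii) implies (i) if $X$ is reflexive and $\varphi$ is weakly sequentially lower semicontinuous around $\bar{x}$.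
   Context: For $\varepsilon \ge 0$ and $\bar x\in\operatorname{dom}\varphi$, the $\varepsilon$-subdifferential is $\widehat\partial_\varepsilon\varphi(\bar{x}) := \{x^* \in X^* : \liminf_{x\to\bar{x}} \frac{\varphi(x)-\varphi(\bar{x})-\langle x^*,x-\bar{x}\rangle}{\|x-\bar{x}\|} \ge -\varepsilon\}$. The limiting subdifferential $\partial\varphi(\bar{x})$ is the set of $x^*\in X^*$ for which there exist sequences $\varepsilon_k \downarrow 0$, $x_k \to \bar{x}$ with $\varphi(x_k)\to\varphi(\bar{x})$, and $x_k^* \in \widehat\partial_{\varepsilon_k}\varphi(x_k)$ with $x_k^* \to x^*$ weakly$^*$. For a convex function the subdifferential $\partial$ is the usual convex-analysis subdifferential. A l.s.c. function $\varphi$ is variationally convex at $\bar{x}$ for $\bar{x}^* \in \partial\varphi(\bar{x})$ if for some convex neighborhood $U\times V$ of $(\bar{x},\bar{x}^* )$ there exist a convex l.s.c. function $\widehat\varphi:X\to(-\infty,\infty]$ with $\widehat\varphi \le \varphi$ on $U$ and $\varepsilon>0$ such that $(U_\varepsilon\times V)\cap \operatorname{gph}\partial\varphi = (U\times V)\cap\operatorname{gph}\partial\widehat\varphi$ and $\varphi(x)=\widehat\varphi(x)$ at the common elements $(x,x^* )$, where $U_\varepsilon := \{x\in U : \varphi(x)<\varphi(\bar{x})+\varepsilon\}$. A function is weakly sequentially l.s.c. at $x$ if $\liminf_k \varphi(x_k)\ge\varphi(x)$ whenever $x_k \to x$ weakly; "around $\bar x$" means at all points of some neighborhood of $\bar{x}$.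 *)

theory Defs
  imports "HOL-Analysis.Analysis"
begin

text \<open>Extended-real valued functions X -> (-infinity, +infinity] are modelled as
  functions into ereal that never take the value -infinity.  The dual X* is the space
  of bounded linear functionals X \<Rightarrow>L real (norm topology).\<close>

definition edom :: "('a \<Rightarrow> ereal) \<Rightarrow> 'a set" where
  "edom f = {x. f x < \<infinity>}"

definition proper_fun :: "('a \<Rightarrow> ereal) \<Rightarrow> bool" where
  "proper_fun f \<longleftrightarrow> (\<forall>x. f x \<noteq> -\<infinity>) \<and> (\<exists>x. f x < \<infinity>)"

definition lsc_fun :: "('a::topological_space \<Rightarrow> ereal) \<Rightarrow> bool" where
  "lsc_fun f \<longleftrightarrow> (\<forall>x. f x \<le> Liminf (at x) f)"

definition convex_efun :: "('a::real_vector \<Rightarrow> ereal) \<Rightarrow> bool" where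
  "convex_efun f \<longleftrightarrow> (\<forall>x y t. 0 < t \<and> t < 1 \<longrightarrow>
      f ((1 - t) *\<^sub>R x + t *\<^sub>R y) \<le> ereal (1 - t) * f x + ereal t * f y)"

definition conv_subdiff :: "('a::real_normed_vector \<Rightarrow> ereal) \<Rightarrow> 'a \<Rightarrow> ('a \<Rightarrow>\<^sub>L real) set" where
  "conv_subdiff f x = {xs. \<bar>f x\<bar> \<noteq> \<infinity> \<and>
      (\<forall>y. f y \<ge> f x + ereal (blinfun_apply xs (y - x)))}"

definition eps_subdiff :: "('a::real_normed_vector \<Rightarrow> ereal) \<Rightarrow> real \<Rightarrow> 'a \<Rightarrow> ('a \<Rightarrow>\<^sub>L real) set" where
  "eps_subdiff f \<epsilon> xb = {xs. \<bar>f xb\<bar> \<noteq> \<infinity> \<and>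
      Liminf (at xb) (\<lambda>x. (f x - f xb - ereal (blinfun_apply xs (x - xb))) / ereal (norm (x - xb)))
        \<ge> - ereal \<epsilon>}"

definition weak_star_conv :: "(nat \<Rightarrow> ('a::real_normed_vector \<Rightarrow>\<^sub>L real)) \<Rightarrow> ('a \<Rightarrow>\<^sub>L real) \<Rightarrow> bool" where
  "weak_star_conv xs x \<longleftrightarrow> (\<forall>v. (\<lambda>k. blinfun_apply (xs k) v) \<longlonglongrightarrow> blinfun_apply x v)"

definition weak_conv :: "(nat \<Rightarrow> 'a::real_normed_vector) \<Rightarrow> 'a \<Rightarrow> bool" where
  "weak_conv xs x \<longleftrightarrow> (\<forall>f :: 'a \<Rightarrow>\<^sub>L real. (\<lambda>k. blinfun_apply f (xs k)) \<longlonglongrightarrow> blinfun_apply f x)"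

definition lim_subdiff :: "('a::real_normed_vector \<Rightarrow> ereal) \<Rightarrow> 'a \<Rightarrow> ('a \<Rightarrow>\<^sub>L real) set" where
  "lim_subdiff f xb = {xs. \<exists>(\<epsilon>::nat \<Rightarrow> real) (x::nat \<Rightarrow> 'a) (ys::nat \<Rightarrow> ('a \<Rightarrow>\<^sub>L real)).
      (\<forall>k. 0 \<le> \<epsilon> k) \<and> decseq \<epsilon> \<and> \<epsilon> \<longlonglongrightarrow> 0 \<and>
      x \<longlonglongrightarrow> xb \<and> (\<lambda>k. f (x k)) \<longlonglongrightarrow> f xb \<and>
      (\<forall>k. ys k \<in> eps_subdiff f (\<epsilon> k) (x k)) \<and> weak_star_conv ys xs}"

definition sublevel_nbhd :: "('a \<Rightarrow> ereal) \<Rightarrow> 'a \<Rightarrow> 'a set \<Rightarrow> real \<Rightarrow> 'a set" where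
  "sublevel_nbhd f xb U \<epsilon> = {x \<in> U. f x < f xb + ereal \<epsilon>}"

definition var_convex :: "('a::real_normed_vector \<Rightarrow> ereal) \<Rightarrow> 'a \<Rightarrow> ('a \<Rightarrow>\<^sub>L real) \<Rightarrow> bool" where
  "var_convex f xb xs \<longleftrightarrow> (\<exists>U V. convex U \<and> convex V \<and> xb \<in> interior U \<and> xs \<in> interior V \<and>
     (\<exists>g \<epsilon>. (\<forall>x. g x \<noteq> -\<infinity>) \<and> convex_efun g \<and> lsc_fun g \<and> (\<forall>x\<in>U. g x \<le> f x) \<and> \<epsilon> > 0 \<and>
        {(x, ys). x \<in> sublevel_nbhd f xb U \<epsilon> \<and> ys \<in> V \<and> ys \<in> lim_subdiff f x}
          = {(x, ys). x \<in> U \<and> ys \<in> V \<and> ys \<in> conv_subdiff g x} \<and>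
        (\<forall>x ys. x \<in> U \<and> ys \<in> V \<and> ys \<in> conv_subdiff g x \<longrightarrow> f x = g x)))"

definition cond_ii :: "('a::real_normed_vector \<Rightarrow> ereal) \<Rightarrow> 'a \<Rightarrow> ('a \<Rightarrow>\<^sub>L real) \<Rightarrow> bool" where
  "cond_ii f xb xs \<longleftrightarrow> (\<exists>U V \<epsilon>. convex U \<and> convex V \<and> xb \<in> interior U \<and> xs \<in> interior V \<and> \<epsilon> > 0 \<and>
     (\<forall>u us. u \<in> sublevel_nbhd f xb U \<epsilon> \<and> us \<in> V \<and> us \<in> lim_subdiff f u \<longrightarrow>
        (\<forall>x\<in>U. f x \<ge> f u + ereal (blinfun_apply us (x - u)))))"

definition reflexive_space :: "'a::real_normed_vector itself \<Rightarrow> bool" where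
  "reflexive_space _ \<longleftrightarrow> (\<forall>\<Phi> :: ('a \<Rightarrow>\<^sub>L real) \<Rightarrow>\<^sub>L real. \<exists>x::'a.
      \<forall>f. blinfun_apply \<Phi> f = blinfun_apply f x)"

definition weak_seq_lsc_at :: "('a::real_normed_vector \<Rightarrow> ereal) \<Rightarrow> 'a \<Rightarrow> bool" where
  "weak_seq_lsc_at f x \<longleftrightarrow> (\<forall>xs. weak_conv xs x \<longrightarrow> liminf (\<lambda>k. f (xs k)) \<ge> f x)"

end

theory Submission
  imports Defs "HOL-Library.Diagonal_Subsequence"
begin

text \<open>
  From (i) to (ii) one reads the subgradient inequality for the convex minorant.
  For the converse, let \<open>g\<close> be the supremum of the affine minorants
  \<open>f u + \<langle>u\<^sup>*, \<cdot> - u\<rangle>\<close> given by (ii). The only hard point is that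
  \<open>f y = g y\<close> whenever \<open>y\<^sup>*\<close> is a subgradient of \<open>g\<close> at \<open>y\<close>, with \<open>(y, y\<^sup>*)\<close> near the
  reference pair. One minimises \<open>f - y\<^sup>* + K (\<cdot> - y)\<close> over a ball, where \<open>K\<close> is convex,
  lies between \<open>\<rho> * norm - \<eta>\<close> and \<open>\<rho> * norm\<close>, and is Frechet differentiable at \<open>u - y\<close> for
  the minimiser \<open>u\<close>. Then \<open>y\<^sup>* - w\<close>, with \<open>w\<close> the derivative, is a subgradient of \<open>f\<close> at \<open>u\<close>;
  monotonicity of the subdifferential of \<open>g\<close> gives \<open>\<langle>w, u - y\<rangle> \<le> 0\<close>, so
  \<open>K (u - y) \<le> 0\<close> and \<open>\<rho> * norm (u - y) \<le> \<eta>\<close>; letting \<open>\<eta>\<close> tend to 0 and using lower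
  semicontinuity gives \<open>f y \<le> g y\<close>.

  A Frechet smooth renorming of \<open>X\<close>, the usual source of such a \<open>K\<close>, is avoided. Take \<open>K\<close> to be the
  conjugate, on the dual ball of radius \<open>\<rho>\<close>, of a series of weighted squared distances to points
  \<open>l i\<close> of the dual space. This \<open>K\<close> is smooth at every point that has a subgradient in the closure
  of the \<open>l i\<close>. A countable closing-off argument chooses the \<open>l i\<close> so that this happens at the
  minimiser, although the minimiser depends on \<open>K\<close>.
\<close>

section \<open>The Hahn-Banach theorem for sublinear functionals\<close>

text \<open>Homogeneity is asked only as an inequality; applying it to \<open>inverse t\<close>
  recovers equality for positive \<open>t\<close>.\<close>

definition sublinear :: "('a::real_vector \<Rightarrow> real) \<Rightarrow> bool" where
  "sublinear p \<longleftrightarrow> (\<forall>x y. p (x + y) \<le> p x + p y) \<and> (\<forall>t\<ge>0. \<forall>x. p (t *\<^sub>R x) \<le> t * p x)"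

lemma sublinearI:
  assumes "\<And>x y. p (x + y) \<le> p x + p y" and "\<And>t x. t > 0 \<Longrightarrow> p (t *\<^sub>R x) \<le> t * p x" and "p 0 \<le> 0"
  shows "sublinear p"
  unfolding sublinear_def
proof (intro conjI allI impI)
  fix t :: real and x assume "t \<ge> 0"
  then show "p (t *\<^sub>R x) \<le> t * p x"
    using assms(2)[of t x] assms(3) by (cases "t = 0") auto
qed (rule assms(1))

lemma sublinear_add: "sublinear p \<Longrightarrow> p (x + y) \<le> p x + p y"
  by (simp add: sublinear_def)

lemma sublinear_scale_le: "sublinear p \<Longrightarrow> t \<ge> 0 \<Longrightarrow> p (t *\<^sub>R x) \<le> t * p x"
  by (simp add: sublinear_def)

lemma sublinear_zero:
  assumes "sublinear p" shows "p 0 = 0"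
  using sublinear_add[OF assms, of 0 0] sublinear_scale_le[OF assms, of 0 0] by simp

lemma sublinear_scale:
  assumes "sublinear p" and "t \<ge> 0" shows "p (t *\<^sub>R x) = t * p x"
proof (cases "t = 0")
  case False
  with assms(2) have "t > 0" by simp
  then have "p x \<le> inverse t * p (t *\<^sub>R x)"
    using sublinear_scale_le[OF assms(1), of "inverse t" "t *\<^sub>R x"] by simp
  then have "t * p x \<le> p (t *\<^sub>R x)"
    using \<open>t > 0\<close> by (simp add: field_simps)
  with sublinear_scale_le[OF assms, of x] show ?thesis by simp
qed (simp add: sublinear_zero[OF assms(1)])

lemma sublinear_minus:
  assumes "sublinear p" shows "- p (- x) \<le> p x"
  using sublinear_add[OF assms, of x "- x"] sublinear_zero[OF assms] by simp

text \<open>A minimal sublinear functional equals all its tilts, hence is additive.\<close>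

lemma sublinear_tilt:
  assumes q: "sublinear q"
  obtains r where "sublinear r" and "\<And>x. r x \<le> q x" and "\<And>x. r x \<le> q (x + y) - q y"
proof -
  \<comment> \<open>The values \<open>t = 0\<close> and \<open>t = 1\<close> give the two upper
    bounds on \<open>r\<close>; the infimum runs over all \<open>t \<ge> 0\<close> so that
    \<open>r\<close> is again sublinear.\<close>
  define r where "r x = (INF t\<in>{0..}. q (x + t *\<^sub>R y) - t * q y)" for x
  have lower: "- q (- x) \<le> q (x + t *\<^sub>R y) - t * q y" if "t \<ge> 0" for x t
    using sublinear_add[OF q, of "x + t *\<^sub>R y" "- x"] sublinear_scale[OF q that, of y] by simp
  have bdd: "bdd_below ((\<lambda>t. q (x + t *\<^sub>R y) - t * q y) ` {0..})" for x
    using lower by (auto intro!: bdd_belowI2[of _ "- q (- x)"])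
  have r_le: "r x \<le> q (x + t *\<^sub>R y) - t * q y" if "t \<ge> 0" for x t
    unfolding r_def by (rule cINF_lower[OF bdd]) (use that in auto)
  have r_ge: "c \<le> r x" if "\<And>t. t \<ge> 0 \<Longrightarrow> c \<le> q (x + t *\<^sub>R y) - t * q y" for c x
    unfolding r_def by (rule cINF_greatest) (use that in auto)
  have "sublinear r"
  proof (rule sublinearI)
    fix a b
    have *: "r (a + b) - (q (b + s *\<^sub>R y) - s * q y) \<le> q (a + t *\<^sub>R y) - t * q y"
      if "t \<ge> 0" "s \<ge> 0" for s t
    proof -
      have "r (a + b) \<le> q ((a + t *\<^sub>R y) + (b + s *\<^sub>R y)) - (t + s) * q y"
        using r_le[of "t + s" "a + b"] that by (simp add: algebra_simps)
      also have "\<dots> \<le> q (a + t *\<^sub>R y) + q (b + s *\<^sub>R y) - (t + s) * q y"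
        using sublinear_add[OF q] by simp
      finally show ?thesis by (simp add: algebra_simps)
    qed
    have "r (a + b) - (q (b + s *\<^sub>R y) - s * q y) \<le> r a" if "s \<ge> 0" for s
      using *[OF _ that] by (rule r_ge)
    then have "r (a + b) - r a \<le> r b"
      by (intro r_ge) (simp add: algebra_simps)
    then show "r (a + b) \<le> r a + r b" by simp
  next
    fix s :: real and x assume "s > 0"
    have "r (s *\<^sub>R x) / s \<le> r x"
    proof (rule r_ge)
      fix t :: real assume "t \<ge> 0"
      have "r (s *\<^sub>R x) \<le> q (s *\<^sub>R (x + t *\<^sub>R y)) - s * t * q y"
        using r_le[of "s * t" "s *\<^sub>R x"] \<open>s > 0\<close> \<open>t \<ge> 0\<close> by (simp add: algebra_simps)
      also have "\<dots> = s * (q (x + t *\<^sub>R y) - t * q y)"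
        using sublinear_scale[OF q, of s "x + t *\<^sub>R y"] \<open>s > 0\<close> by (simp add: right_diff_distrib mult.assoc)
      finally show "r (s *\<^sub>R x) / s \<le> q (x + t *\<^sub>R y) - t * q y"
        using \<open>s > 0\<close> by (simp add: field_simps)
    qed
    then show "r (s *\<^sub>R x) \<le> s * r x" using \<open>s > 0\<close> by (simp add: field_simps)
  next
    show "r 0 \<le> 0" using r_le[of 0 0] sublinear_zero[OF q] by simp
  qed
  moreover have "r x \<le> q x" for x using r_le[of 0 x] by simp
  moreover have "r x \<le> q (x + y) - q y" for x using r_le[of 1 x] by simp
  ultimately show thesis by (rule that)
qed

text \<open>Supplies the bound for chains in Zorn's lemma. The pointwise infimum is finite because
  each member is at least \<open>- p (- x)\<close>, and subadditive because the smaller of two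
  members can be used at both points.\<close>

lemma sublinear_chain_Inf:
  assumes "C \<noteq> {}" and sub: "\<And>q. q \<in> C \<Longrightarrow> sublinear q \<and> q \<le> p"
    and chain: "\<And>q r. q \<in> C \<Longrightarrow> r \<in> C \<Longrightarrow> q \<le> r \<or> r \<le> q"
  shows "\<exists>s. sublinear s \<and> s \<le> p \<and> (\<forall>q\<in>C. s \<le> q)"
proof -
  define s where "s x = (INF q\<in>C. q x)" for x
  have bdd: "bdd_below ((\<lambda>q. q x) ` C)" for x
  proof (rule bdd_belowI2)
    fix q assume "q \<in> C"
    then show "- p (- x) \<le> q x"
      using sub[of q] sublinear_minus[of q x] by (force simp: le_fun_def intro: order_trans[rotated])
  qed
  have s_le: "s x \<le> q x" if "q \<in> C" for q x
    unfolding s_def by (rule cINF_lower[OF bdd that])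
  have s_ge: "c \<le> s x" if "\<And>q. q \<in> C \<Longrightarrow> c \<le> q x" for c x
    unfolding s_def by (rule cINF_greatest[OF assms(1) that])
  have "sublinear s"
  proof (rule sublinearI)
    fix a b
    have *: "s (a + b) - r b \<le> q a" if "q \<in> C" "r \<in> C" for q r
      using chain[OF that]
    proof
      assume "q \<le> r"
      then show ?thesis using s_le[OF that(1), of "a + b"] sublinear_add[of q a b] sub[OF that(1)]
        by (force simp: le_fun_def dest: spec[of _ b])
    next
      assume "r \<le> q"
      then show ?thesis using s_le[OF that(2), of "a + b"] sublinear_add[of r a b] sub[OF that(2)]
        by (force simp: le_fun_def dest: spec[of _ a])
    qed
    have "s (a + b) - r b \<le> s a" if "r \<in> C" for r
      using *[OF _ that] by (rule s_ge)
    then have "s (a + b) - s a \<le> s b" by (intro s_ge) (simp add: algebra_simps)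
    then show "s (a + b) \<le> s a + s b" by simp
  next
    fix t :: real and x assume "t > 0"
    have "s (t *\<^sub>R x) / t \<le> s x"
    proof (rule s_ge)
      fix q assume "q \<in> C"
      then show "s (t *\<^sub>R x) / t \<le> q x"
        using s_le[of q "t *\<^sub>R x"] sublinear_scale[of q t x] sub[of q] \<open>t > 0\<close>
        by (simp add: field_simps)
    qed
    then show "s (t *\<^sub>R x) \<le> t * s x" using \<open>t > 0\<close> by (simp add: field_simps)
  next
    obtain q where "q \<in> C" using assms(1) by blast
    then show "s 0 \<le> 0" using s_le[of q 0] sub[of q] sublinear_zero[of q] by simp
  qed
  moreover have "s \<le> p" using assms(1) s_le sub by (fastforce simp: le_fun_def intro: order_trans)
  ultimately show ?thesis using s_le by (auto simp: le_fun_def)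
qed

lemma linear_below_sublinear:
  assumes p: "sublinear p"
  shows "\<exists>f. linear f \<and> (\<forall>x. f x \<le> p x)"
proof -
  define A where "A = {q. sublinear q \<and> q \<le> p}"
  have "\<exists>m\<in>A. \<forall>a\<in>A. a \<le> m \<longrightarrow> a = m"
  proof (rule predicate_Zorn)
    \<comment> \<open>The order is reversed, so a maximal element is a minimal functional.\<close>
    show "partial_order_on A (relation_of (\<lambda>a b. b \<le> a) A)"
      by (rule partial_order_on_relation_ofI) auto
  next
    fix C assume C: "C \<in> Chains (relation_of (\<lambda>a b. b \<le> a) A)"
    show "\<exists>u\<in>A. \<forall>a\<in>C. u \<le> a"
    proof (cases "C = {}")
      case True then show ?thesis using p by (auto simp: A_def)
    next
      case False
      have "\<exists>s. sublinear s \<and> s \<le> p \<and> (\<forall>q\<in>C. s \<le> q)"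
        by (rule sublinear_chain_Inf[OF False])
          (use C in \<open>auto simp: Chains_def relation_of_def A_def\<close>)
      then show ?thesis by (auto simp: A_def)
    qed
  qed
  then obtain m where m: "sublinear m" "m \<le> p" and min: "\<And>a. sublinear a \<Longrightarrow> a \<le> m \<Longrightarrow> a = m"
    by (auto simp: A_def intro: order_trans)
  \<comment> \<open>The tilt of \<open>m\<close> in direction \<open>y\<close> lies below
    \<open>m\<close>, hence equals \<open>m\<close>; its second upper bound then says that
    \<open>m\<close> is superadditive.\<close>
  have superadd: "m x + m y \<le> m (x + y)" for x y
  proof -
    obtain r where r: "sublinear r" "\<And>x. r x \<le> m x" "\<And>x. r x \<le> m (x + y) - m y"
      using sublinear_tilt[OF m(1)] by blast
    then have "r = m" by (intro min) (auto simp: le_fun_def)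
    then show ?thesis using r(3)[of x] by simp
  qed
  then have add: "m (x + y) = m x + m y" for x y
    using sublinear_add[OF m(1), of x y] by (force intro: antisym)
  have neg: "m (- x) = - m x" for x
    using add[of x "- x"] sublinear_zero[OF m(1)] by simp
  have "m (t *\<^sub>R x) = t * m x" for t x
  proof (cases "t \<ge> 0")
    case True then show ?thesis by (rule sublinear_scale[OF m(1)])
  next
    case False
    then show ?thesis using sublinear_scale[OF m(1), of "- t" x] neg[of "t *\<^sub>R x"] by simp
  qed
  then have "linear m" by (intro linearI) (auto simp: add)
  then show ?thesis using m(2) by (auto simp: le_fun_def)
qed

text \<open>Tilting \<open>p\<close> in direction \<open>z\<close> first gives
  \<open>r (- z) \<le> - p z\<close>, so every linear functional below \<open>r\<close> takes the
  value \<open>p z\<close> at \<open>z\<close>.\<close>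

theorem Hahn_Banach_sublinear:
  assumes p: "sublinear p"
  shows "\<exists>f. linear f \<and> (\<forall>x. f x \<le> p x) \<and> f z = p z"
proof -
  obtain r where r: "sublinear r" "\<And>x. r x \<le> p x" "\<And>x. r x \<le> p (x + z) - p z"
    using sublinear_tilt[OF p] by blast
  obtain f where f: "linear f" "\<And>x. f x \<le> r x"
    using linear_below_sublinear[OF r(1)] by blast
  have "f (- z) \<le> - p z"
    using f(2)[of "- z"] r(3)[of "- z"] sublinear_zero[OF p] by simp
  then have "p z \<le> f z" using linear_neg[OF f(1)] by simp
  moreover have "f x \<le> p x" for x using f(2) r(2) order_trans by blast
  ultimately show ?thesis using f(1) by (meson antisym)
qed

section \<open>Continuous functionals on a normed space\<close>

lemma Hahn_Banach_blinfun:
  fixes p :: "'a::real_normed_vector \<Rightarrow> real"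
  assumes p: "sublinear p" and bnd: "\<And>x. p x \<le> K * norm x"
  shows "\<exists>\<phi> :: 'a \<Rightarrow>\<^sub>L real. (\<forall>x. blinfun_apply \<phi> x \<le> p x) \<and> blinfun_apply \<phi> z = p z"
proof -
  obtain f where f: "linear f" "\<And>x. f x \<le> p x" "f z = p z"
    using Hahn_Banach_sublinear[OF p] by blast
  have "\<bar>f x\<bar> \<le> K * norm x" for x
    using f(2)[of x] f(2)[of "- x"] bnd[of x] bnd[of "- x"] linear_neg[OF f(1), of x] by simp
  then have "bounded_linear f"
    using f(1) by (intro bounded_linear_intro[where K = K])
      (auto simp: linear_add linear_scale mult.commute)
  then show ?thesis using f(2,3) by (metis bounded_linear_Blinfun_apply)
qed

lemma norming_functional:
  fixes z :: "'a::real_normed_vector"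
  shows "\<exists>\<phi> :: 'a \<Rightarrow>\<^sub>L real. norm \<phi> \<le> 1 \<and> blinfun_apply \<phi> z = norm z"
proof -
  have "sublinear (norm :: 'a \<Rightarrow> real)" by (rule sublinearI) (auto simp: norm_triangle_ineq)
  then obtain \<phi> :: "'a \<Rightarrow>\<^sub>L real" where \<phi>: "\<And>x. blinfun_apply \<phi> x \<le> norm x" "blinfun_apply \<phi> z = norm z"
    using Hahn_Banach_blinfun[of norm 1 z] by auto
  have "\<bar>blinfun_apply \<phi> x\<bar> \<le> norm x" for x
    using \<phi>(1)[of x] \<phi>(1)[of "- x"] by (simp add: blinfun.minus_right)
  then show ?thesis using \<phi>(2) by (intro exI[of _ \<phi>]) (auto intro: norm_blinfun_bound)
qed

text \<open>The distance to \<open>S\<close> is sublinear, vanishes on \<open>S\<close> and is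
  positive at \<open>z\<close> since \<open>S\<close> is closed; a functional below it that agrees
  with it at \<open>z\<close> separates.\<close>

lemma separating_functional:
  fixes S :: "'a::real_normed_vector set"
  assumes S: "subspace S" and "closed S" and "z \<notin> S"
  shows "\<exists>\<phi> :: 'a \<Rightarrow>\<^sub>L real. (\<forall>x\<in>S. blinfun_apply \<phi> x = 0) \<and> blinfun_apply \<phi> z \<noteq> 0"
proof -
  have ne: "S \<noteq> {}" using subspace_0[OF S] by blast
  have le: "infdist x S \<le> dist x s" if "s \<in> S" for x s by (rule infdist_le[OF that])
  have approx: "\<exists>s\<in>S. dist x s < infdist x S + e" if "e > 0" for x e
  proof (rule ccontr)
    assume "\<not> ?thesis"
    then have "infdist x S + e \<le> infdist x S"
      unfolding infdist_notempty[OF ne] by (intro cINF_greatest[OF ne]) (auto simp: not_less)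
    then show False using that by simp
  qed
  have "sublinear (\<lambda>x. infdist x S)"
  proof (rule sublinearI)
    fix x y
    show "infdist (x + y) S \<le> infdist x S + infdist y S"
    proof (rule field_le_epsilon)
      fix e :: real assume "e > 0"
      obtain s t where st: "s \<in> S" "t \<in> S" "dist x s < infdist x S + e / 2" "dist y t < infdist y S + e / 2"
        using approx[of "e / 2"] \<open>e > 0\<close> by (meson half_gt_zero)
      have "infdist (x + y) S \<le> dist (x + y) (s + t)" using st subspace_add[OF S] by (intro le) auto
      also have "\<dots> \<le> dist x s + dist y t" by (rule dist_triangle_add)
      finally show "infdist (x + y) S \<le> infdist x S + infdist y S + e" using st by simp
    qed
  next
    fix t :: real and x assume "t > 0"
    show "infdist (t *\<^sub>R x) S \<le> t * infdist x S"
    proof (rule field_le_epsilon)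
      fix e :: real assume "e > 0"
      obtain s where s: "s \<in> S" "dist x s < infdist x S + e / t"
        using approx[of "e / t"] \<open>e > 0\<close> \<open>t > 0\<close> by (meson divide_pos_pos)
      have "infdist (t *\<^sub>R x) S \<le> dist (t *\<^sub>R x) (t *\<^sub>R s)"
        using s subspace_scale[OF S] by (intro le) auto
      also have "\<dots> = t * dist x s"
        using \<open>t > 0\<close> by (simp add: dist_norm flip: scaleR_diff_right)
      also have "\<dots> \<le> t * (infdist x S + e / t)" using s \<open>t > 0\<close> by (intro mult_left_mono) auto
      also have "\<dots> = t * infdist x S + e" using \<open>t > 0\<close> by (simp add: distrib_left)
      finally show "infdist (t *\<^sub>R x) S \<le> t * infdist x S + e" .
    qed
  qed (use subspace_0[OF S] in simp)
  moreover have "infdist x S \<le> 1 * norm x" for x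
    using le[OF subspace_0[OF S], of x] by (simp add: dist_norm)
  ultimately obtain \<phi> :: "'a \<Rightarrow>\<^sub>L real" where \<phi>: "\<And>x. blinfun_apply \<phi> x \<le> infdist x S" "blinfun_apply \<phi> z = infdist z S"
    using Hahn_Banach_blinfun[of "\<lambda>x. infdist x S" 1 z] by auto
  have "blinfun_apply \<phi> x = 0" if "x \<in> S" for x
    using \<phi>(1)[of x] \<phi>(1)[of "- x"] that subspace_neg[OF S that]
    by (simp add: blinfun.minus_right)
  moreover have "infdist z S \<noteq> 0"
    using in_closed_iff_infdist_zero[OF assms(2) ne] assms(3) by blast
  ultimately show ?thesis by (intro exI[of _ \<phi>]) (simp add: \<phi>(2))
qed

section \<open>Weak sequential compactness in reflexive spaces\<close>

text \<open>\<open>op xs m\<close> stands for the \<open>m\<close>-th operation applied to the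
  arguments \<open>xs\<close>, so one function encodes countably many finitary operations. The
  stages increase, so each finite list of arguments already lies in one stage.\<close>

lemma countable_closing:
  fixes op :: "'a list \<Rightarrow> nat \<Rightarrow> 'a"
  assumes "countable A"
  obtains S where "countable S" and "A \<subseteq> S" and "\<And>xs m. xs \<in> lists S \<Longrightarrow> op xs m \<in> S"
proof -
  define step where "step X = X \<union> (\<lambda>(xs, m). op xs m) ` (lists X \<times> UNIV)" for X
  define T where "T n = (step ^^ n) A" for n
  have T_Suc: "T (Suc n) = step (T n)" for n by (simp add: T_def)
  have "countable (T n)" for n
    by (induction n) (auto simp: T_def step_def assms intro!: countable_Un countable_image countable_SIGMA)
  then have "countable (\<Union>n. T n)" by blast
  moreover have "A \<subseteq> (\<Union>n. T n)" using UN_upper[of 0 UNIV T] by (simp add: T_def)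
  moreover have "op xs m \<in> (\<Union>n. T n)" if xs: "xs \<in> lists (\<Union>n. T n)" for xs m
  proof -
    have "incseq T" by (rule incseq_SucI) (auto simp: T_Suc step_def)
    have "\<exists>n. xs \<in> lists (T n)"
      using xs
    proof (induction xs)
      case (Cons x xs)
      then obtain n k where "x \<in> T k" "xs \<in> lists (T n)" by auto
      moreover have "T k \<subseteq> T (max k n)" "T n \<subseteq> T (max k n)"
        using \<open>incseq T\<close> by (auto simp: incseq_def)
      ultimately have "x # xs \<in> lists (T (max k n))" by auto
      then show ?case by blast
    qed auto
    then obtain n where "xs \<in> lists (T n)" by blast
    then have "op xs m \<in> T (Suc n)" unfolding T_Suc step_def by force
    then show ?thesis by blast
  qed
  ultimately show thesis by (rule that)
qed

text \<open>Rational scalars are coded by naturals to fit the closing-off operations; approximating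
  real scalars by rationals handles the closure.\<close>

lemma subspace_closure_rat_closed:
  fixes S :: "'a::real_normed_vector set"
  assumes "S \<noteq> {}" and S: "\<And>p q m. p \<in> S \<Longrightarrow> q \<in> S \<Longrightarrow> real_of_rat (from_nat m) *\<^sub>R p + q \<in> S"
  shows "subspace (closure S)"
proof -
  have rat: "real_of_rat r *\<^sub>R p + q \<in> S" if "p \<in> S" "q \<in> S" for r p q
    using S[OF that, of "to_nat r"] by simp
  have comb: "c *\<^sub>R a + b \<in> closure S" if ab: "a \<in> closure S" "b \<in> closure S" for a b and c :: real
  proof -
    obtain p where p: "\<And>n. p n \<in> S" "p \<longlonglongrightarrow> a"
      using ab(1) unfolding closure_sequential by blast
    obtain q where q: "\<And>n. q n \<in> S" "q \<longlonglongrightarrow> b"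
      using ab(2) unfolding closure_sequential by blast
    obtain r where r: "\<And>n. r n \<in> \<rat>" "r \<longlonglongrightarrow> c"
      using Rats_closure_real closure_sequential[of c \<rat>] by auto
    have "r n *\<^sub>R p n + q n \<in> S" for n
      using r(1)[of n] rat p q by (metis Rats_cases)
    moreover have "(\<lambda>n. r n *\<^sub>R p n + q n) \<longlonglongrightarrow> c *\<^sub>R a + b"
      using r p q by (intro tendsto_intros)
    ultimately show ?thesis unfolding closure_sequential
      by (intro exI[of _ "\<lambda>n. r n *\<^sub>R p n + q n"]) simp
  qed
  obtain s where "s \<in> S" using assms(1) by blast
  then have "s \<in> closure S" using closure_subset by blast
  then have 0: "0 \<in> closure S" using comb[of s s "-1"] by simp
  show ?thesis
    unfolding subspace_def using 0 comb[of _ _ 1] comb[of _ 0] by simp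
qed

text \<open>Composing \<open>\<Psi>\<close> with the evaluation map gives a functional
  \<open>f\<close> on the space; as every element of the bidual is an evaluation,
  \<open>\<Psi>\<close> is evaluation at \<open>f\<close>.\<close>

lemma reflexive_space_dual:
  assumes "reflexive_space TYPE('a::real_normed_vector)"
  shows "reflexive_space TYPE('a \<Rightarrow>\<^sub>L real)"
  unfolding reflexive_space_def
proof
  fix \<Psi> :: "(('a \<Rightarrow>\<^sub>L real) \<Rightarrow>\<^sub>L real) \<Rightarrow>\<^sub>L real"
  define ev :: "'a \<Rightarrow> (('a \<Rightarrow>\<^sub>L real) \<Rightarrow>\<^sub>L real)"
    where "ev x = Blinfun (\<lambda>f. blinfun_apply f x)" for x
  have ev: "blinfun_apply (ev x) f = blinfun_apply f x" for x f
    unfolding ev_def by (subst bounded_linear_Blinfun_apply) (auto intro: bounded_linear_intros)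
  have "bounded_linear (\<lambda>x. blinfun_apply \<Psi> (ev x))"
  proof (rule bounded_linear_intro)
    show "norm (blinfun_apply \<Psi> (ev x)) \<le> norm x * norm \<Psi>" for x
    proof -
      have "norm (ev x) \<le> norm x"
        by (rule norm_blinfun_bound) (simp_all add: ev mult.commute[of "norm x"] norm_blinfun del: real_norm_def)
      then have "norm \<Psi> * norm (ev x) \<le> norm \<Psi> * norm x" by (rule mult_left_mono) simp
      then show ?thesis using norm_blinfun[of \<Psi> "ev x"] by (simp add: mult.commute)
    qed
    have "ev (x + y) = ev x + ev y" for x y
      by (rule blinfun_eqI) (simp add: ev blinfun.add_left blinfun.add_right)
    then show "blinfun_apply \<Psi> (ev (x + y)) = blinfun_apply \<Psi> (ev x) + blinfun_apply \<Psi> (ev y)" for x y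
      by (simp add: blinfun.add_right)
    have "ev (r *\<^sub>R x) = r *\<^sub>R ev x" for r x
      by (rule blinfun_eqI) (simp add: ev blinfun.scaleR_left blinfun.scaleR_right)
    then show "blinfun_apply \<Psi> (ev (r *\<^sub>R x)) = r *\<^sub>R blinfun_apply \<Psi> (ev x)" for r x
      by (simp add: blinfun.scaleR_right)
  qed
  then obtain f :: "'a \<Rightarrow>\<^sub>L real" where f: "\<And>x. blinfun_apply f x = blinfun_apply \<Psi> (ev x)"
    by (metis bounded_linear_Blinfun_apply)
  have "blinfun_apply \<Psi> \<Phi> = blinfun_apply \<Phi> f" for \<Phi>
  proof -
    obtain x where "\<forall>f. blinfun_apply \<Phi> f = blinfun_apply f x"
      using assms unfolding reflexive_space_def by blast
    then have "\<Phi> = ev x" and "blinfun_apply \<Phi> f = blinfun_apply f x"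
      by (auto intro: blinfun_eqI simp: ev)
    then show ?thesis by (simp add: f)
  qed
  then show "\<exists>f. \<forall>\<Phi>. blinfun_apply \<Psi> \<Phi> = blinfun_apply \<Phi> f" by blast
qed

text \<open>The upper limit along the sequence is a sublinear functional on the dual space; by reflexivity,
  the linear functionals below it are evaluations.\<close>

lemma reflexive_cluster_point:
  fixes x :: "nat \<Rightarrow> 'a::real_normed_vector"
  assumes refl: "reflexive_space TYPE('a)" and K: "\<And>n. norm (x n) \<le> K"
  obtains z where "\<And>f :: 'a \<Rightarrow>\<^sub>L real. ereal (blinfun_apply f z) \<le> limsup (\<lambda>n. ereal (blinfun_apply f (x n)))"
proof -
  define L where "L f = limsup (\<lambda>n. ereal (blinfun_apply f (x n)))" for f :: "'a \<Rightarrow>\<^sub>L real"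
  have le: "\<bar>blinfun_apply f (x n)\<bar> \<le> K * norm f" for f n
    using norm_blinfun[of f "x n"] mult_left_mono[OF K[of n], of "norm f"] by (simp add: mult.commute)
  have upper: "L f \<le> ereal (K * norm f)" for f
    unfolding L_def by (rule Limsup_bounded) (use le in \<open>auto simp: abs_le_iff\<close>)
  have lower: "ereal (- (K * norm f)) \<le> L f" for f
    unfolding L_def by (rule le_Limsup) (use le in \<open>auto simp: abs_le_iff minus_le_iff\<close>)
  have fin: "\<bar>L f\<bar> \<noteq> \<infinity>" for f
    using upper[of f] lower[of f] by auto
  then have L: "ereal (real_of_ereal (L f)) = L f" for f by (rule ereal_real')
  have "sublinear (\<lambda>f. real_of_ereal (L f))"
  proof (rule sublinearI)
    fix f g
    have "L (f + g) \<le> L f + L g"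
      unfolding L_def
      using ereal_limsup_add_mono[of "\<lambda>n. ereal (blinfun_apply f (x n))" "\<lambda>n. ereal (blinfun_apply g (x n))"]
      by (simp add: blinfun.add_left)
    then show "real_of_ereal (L (f + g)) \<le> real_of_ereal (L f) + real_of_ereal (L g)"
      by (metis L ereal_less_eq(3) plus_ereal.simps(1))
  next
    fix t :: real and f assume "t > 0"
    then have "L (t *\<^sub>R f) = ereal t * L f"
      unfolding L_def using limsup_ereal_mult_left[of t "\<lambda>n. ereal (blinfun_apply f (x n))"]
      by (simp add: blinfun.scaleR_left)
    then show "real_of_ereal (L (t *\<^sub>R f)) \<le> t * real_of_ereal (L f)" by simp
  next
    show "real_of_ereal (L 0) \<le> 0" by (simp add: L_def Limsup_const)
  qed
  moreover have "real_of_ereal (L f) \<le> K * norm f" for f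
    using upper[of f] by (metis L ereal_less_eq(3))
  ultimately obtain \<Phi> :: "('a \<Rightarrow>\<^sub>L real) \<Rightarrow>\<^sub>L real" where \<Phi>: "\<And>f. blinfun_apply \<Phi> f \<le> real_of_ereal (L f)"
    using Hahn_Banach_blinfun[of "\<lambda>f. real_of_ereal (L f)" K] by meson
  obtain z where "\<forall>f. blinfun_apply \<Phi> f = blinfun_apply f z"
    using refl unfolding reflexive_space_def by blast
  then have "ereal (blinfun_apply f z) \<le> L f" for f
    using \<Phi>[of f] by (metis L ereal_less_eq(3))
  then show thesis unfolding L_def by (rule that)
qed

lemma weak_conv_in_subspace:
  fixes x :: "nat \<Rightarrow> 'a::real_normed_vector"
  assumes "weak_conv x z" and "\<And>n. x n \<in> S" and "subspace S" and "closed S"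
  shows "z \<in> S"
proof (rule ccontr)
  assume "z \<notin> S"
  then obtain \<phi> :: "'a \<Rightarrow>\<^sub>L real" where \<phi>: "\<forall>x\<in>S. blinfun_apply \<phi> x = 0" "blinfun_apply \<phi> z \<noteq> 0"
    using separating_functional[OF assms(3,4)] by blast
  have "(\<lambda>n. blinfun_apply \<phi> (x n)) \<longlonglongrightarrow> blinfun_apply \<phi> z"
    using assms(1) unfolding weak_conv_def by blast
  then have "(\<lambda>n. 0) \<longlonglongrightarrow> blinfun_apply \<phi> z" using \<phi>(1) assms(2) by simp
  then show False using \<phi>(2) by (simp add: LIMSEQ_const_iff)
qed

text \<open>It suffices to test the weak limit with a functional that norms
  \<open>z - c\<close>.\<close>

lemma weak_conv_norm_le:
  fixes x :: "nat \<Rightarrow> 'a::real_normed_vector"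
  assumes "weak_conv x z" and "\<And>n. norm (x n - c) \<le> R"
  shows "norm (z - c) \<le> R"
proof -
  obtain \<phi> :: "'a \<Rightarrow>\<^sub>L real" where \<phi>: "norm \<phi> \<le> 1" "blinfun_apply \<phi> (z - c) = norm (z - c)"
    using norming_functional by blast
  have "(\<lambda>n. blinfun_apply \<phi> (x n - c)) \<longlonglongrightarrow> blinfun_apply \<phi> (z - c)"
    using assms(1) unfolding weak_conv_def blinfun.diff_right by (intro tendsto_diff) auto
  moreover have "blinfun_apply \<phi> (x n - c) \<le> R" for n
  proof -
    have "blinfun_apply \<phi> (x n - c) \<le> norm \<phi> * norm (x n - c)"
      using norm_blinfun[of \<phi> "x n - c"] by simp
    also have "\<dots> \<le> 1 * R" using \<phi>(1) assms(2) by (intro mult_mono) auto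
    finally show ?thesis by simp
  qed
  ultimately show ?thesis using \<phi>(2) by (metis LIMSEQ_le_const2)
qed

text \<open>The sequence lies in a separable closed subspace, where countably many functionals
  \<open>\<phi> i\<close> separate points. A diagonal subsequence converges under all of them, so
  its cluster points, which exist by reflexivity and lie in that subspace, coincide.\<close>

theorem reflexive_weak_compact:
  fixes x :: "nat \<Rightarrow> 'a::real_normed_vector"
  assumes refl: "reflexive_space TYPE('a)" and K: "\<And>n. norm (x n) \<le> K"
  obtains r z where "strict_mono r" and "weak_conv (x \<circ> r) z"
proof -
  \<comment> \<open>Only the first two list entries matter; on shorter lists the unspecified values
    merely enlarge the countable set \<open>V\<close>.\<close>
  obtain V where V: "countable V" "range x \<subseteq> V"
    "\<And>xs m. xs \<in> lists V \<Longrightarrow> real_of_rat (from_nat m) *\<^sub>R (xs ! 0) + xs ! 1 \<in> V"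
    by (rule countable_closing[of "range x" "\<lambda>xs m. real_of_rat (from_nat m) *\<^sub>R (xs ! 0) + xs ! 1"]) auto
  have "V \<noteq> {}" using V(2) by auto
  have sub: "subspace (closure V)"
  proof (rule subspace_closure_rat_closed[OF \<open>V \<noteq> {}\<close>])
    fix p q m assume "p \<in> V" "q \<in> V"
    then show "real_of_rat (from_nat m) *\<^sub>R p + q \<in> V" using V(3)[of "[p, q]" m] by simp
  qed
  define v where "v = from_nat_into V"
  have range_v: "range v = V" unfolding v_def using V(1) \<open>V \<noteq> {}\<close> by (simp add: range_from_nat_into)
  have "\<forall>i. \<exists>\<phi> :: 'a \<Rightarrow>\<^sub>L real. norm \<phi> \<le> 1 \<and> blinfun_apply \<phi> (v i) = norm (v i)"
    using norming_functional by blast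
  then obtain \<phi> :: "nat \<Rightarrow> 'a \<Rightarrow>\<^sub>L real" where \<phi>: "\<And>i. norm (\<phi> i) \<le> 1" "\<And>i. blinfun_apply (\<phi> i) (v i) = norm (v i)"
    by metis
  \<comment> \<open>If all \<open>\<phi> i\<close> vanish at \<open>a\<close>, then
    \<open>norm (v i) = \<phi> i (v i - a) \<le> norm (v i - a)\<close>, which is small for
    \<open>v i\<close> close to \<open>a\<close>.\<close>
  have separates: "a = 0" if a: "a \<in> closure V" "\<And>i. blinfun_apply (\<phi> i) a = 0" for a
  proof -
    have "norm a \<le> 0 + e" if "e > 0" for e
    proof -
      obtain i where i: "dist (v i) a < e / 2"
        using a(1) \<open>e > 0\<close> range_v unfolding closure_approachable by (metis half_gt_zero imageE)
      have "norm (v i) = blinfun_apply (\<phi> i) (v i - a)" using \<phi>(2) a(2) by (simp add: blinfun.diff_right)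
      also have "\<dots> \<le> norm (\<phi> i) * norm (v i - a)" using norm_blinfun[of "\<phi> i" "v i - a"] by simp
      also have "\<dots> \<le> 1 * norm (v i - a)" by (intro mult_right_mono \<phi>) auto
      finally have "norm (v i) < e / 2" using i by (simp add: dist_norm)
      then show ?thesis using i norm_triangle_ineq[of "v i" "a - v i"] by (simp add: dist_norm norm_minus_commute)
    qed
    then have "norm a \<le> 0" by (rule field_le_epsilon)
    then show ?thesis by simp
  qed
  have bnd: "\<bar>blinfun_apply f (x n)\<bar> \<le> norm f * K" for f :: "'a \<Rightarrow>\<^sub>L real" and n
    using norm_blinfun[of f "x n"] mult_left_mono[OF K[of n], of "norm f"] by simp
  have conv_sub: "\<exists>l r'. strict_mono r' \<and> ((\<lambda>k. blinfun_apply f (x (s k))) \<circ> r') \<longlonglongrightarrow> l" for f :: "'a \<Rightarrow>\<^sub>L real" and s :: "nat \<Rightarrow> nat"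
  proof -
    have "bounded (range (\<lambda>k. blinfun_apply f (x (s k))))" using bnd by (intro boundedI[where B = "norm f * K"]) auto
    then show ?thesis by (metis bounded_imp_convergent_subsequence)
  qed
  interpret subseqs "\<lambda>i s. convergent (\<lambda>k. blinfun_apply (\<phi> i) (x (s k)))"
  proof
    fix n and s :: "nat \<Rightarrow> nat"
    show "\<exists>r'. strict_mono r' \<and> convergent (\<lambda>k. blinfun_apply (\<phi> n) (x ((s \<circ> r') k)))"
      using conv_sub[of "\<phi> n" s] by (auto simp: convergent_def o_def)
  qed
  define d where "d = diagseq"
  have d: "strict_mono d" unfolding d_def by (rule subseq_diagseq)
  have conv: "convergent (\<lambda>k. blinfun_apply (\<phi> i) (x (d k)))" for i
  proof -
    \<comment> \<open>Only the tail of the diagonal sequence from \<open>Suc i\<close> on is known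
      to refine the subsequence chosen for \<open>\<phi> i\<close>.\<close>
    have "convergent (\<lambda>k. blinfun_apply (\<phi> i) (x ((diagseq \<circ> ((+) (Suc i))) k)))"
    proof (rule diagseq_holds)
      fix r s :: "nat \<Rightarrow> nat" and n
      assume "strict_mono r" and "convergent (\<lambda>k. blinfun_apply (\<phi> n) (x (s k)))"
      then show "convergent (\<lambda>k. blinfun_apply (\<phi> n) (x ((s \<circ> r) k)))"
        using convergent_subseq_convergent[of "\<lambda>k. blinfun_apply (\<phi> n) (x (s k))" r] by (simp add: o_def)
    qed
    then have "convergent (\<lambda>k. blinfun_apply (\<phi> i) (x (diagseq (k + Suc i))))" by (simp add: add.commute o_def)
    then show ?thesis unfolding d_def
      using convergent_ignore_initial_segment[of "\<lambda>k. blinfun_apply (\<phi> i) (x (diagseq k))" "Suc i"] by blast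
  qed
  have cluster: "\<exists>z\<in>closure V. \<forall>f l. (\<lambda>k. blinfun_apply f (x (s k))) \<longlonglongrightarrow> l \<longrightarrow> blinfun_apply (f :: 'a \<Rightarrow>\<^sub>L real) z = l" for s :: "nat \<Rightarrow> nat"
  proof -
    obtain z where z: "\<And>f :: 'a \<Rightarrow>\<^sub>L real. ereal (blinfun_apply f z) \<le> limsup (\<lambda>n. ereal (blinfun_apply f (x (s n))))"
      using reflexive_cluster_point[OF refl, of "x \<circ> s" K] K by auto
    \<comment> \<open>The bound by the upper limit, used for \<open>f\<close> and for
      \<open>- f\<close>, becomes an equality when the values converge.\<close>
    have eq: "blinfun_apply f z = l" if l: "(\<lambda>k. blinfun_apply f (x (s k))) \<longlonglongrightarrow> l" for f :: "'a \<Rightarrow>\<^sub>L real" and l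
    proof -
      have *: "blinfun_apply f z \<le> l" if l: "(\<lambda>k. blinfun_apply f (x (s k))) \<longlonglongrightarrow> l" for f :: "'a \<Rightarrow>\<^sub>L real" and l
      proof -
        have "limsup (\<lambda>k. ereal (blinfun_apply f (x (s k)))) = ereal l"
          using l by (intro lim_imp_Limsup) auto
        then show ?thesis using z[of f] by simp
      qed
      have "(\<lambda>k. blinfun_apply (- f) (x (s k))) \<longlonglongrightarrow> - l"
        using l by (simp add: blinfun.minus_left tendsto_minus)
      from *[OF this] *[OF l] show ?thesis by (simp add: blinfun.minus_left)
    qed
    have "z \<in> closure V"
    proof (rule ccontr)
      assume "z \<notin> closure V"
      then obtain f :: "'a \<Rightarrow>\<^sub>L real" where f: "\<forall>x\<in>closure V. blinfun_apply f x = 0" "blinfun_apply f z \<noteq> 0"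
        using separating_functional[OF sub] by blast
      have "x n \<in> closure V" for n using V(2) closure_subset by blast
      then show False using f eq[of f 0] by simp
    qed
    then show ?thesis using eq by blast
  qed
  obtain z where z: "z \<in> closure V" "\<And>(f :: 'a \<Rightarrow>\<^sub>L real) l. (\<lambda>k. blinfun_apply f (x (d k))) \<longlonglongrightarrow> l \<Longrightarrow> blinfun_apply f z = l"
    using cluster[of d] by blast
  have "(\<lambda>k. blinfun_apply g (x (d k))) \<longlonglongrightarrow> blinfun_apply g z" for g :: "'a \<Rightarrow>\<^sub>L real"
  proof (rule ccontr)
    assume "\<not> ?thesis"
    then obtain e where "e > 0" and e: "\<forall>N. \<exists>n\<ge>N. \<not> dist (blinfun_apply g (x (d n))) (blinfun_apply g z) < e"
      unfolding lim_sequentially by blast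
    define I where "I = {n. e \<le> dist (blinfun_apply g (x (d n))) (blinfun_apply g z)}"
    have "infinite I" unfolding infinite_nat_iff_unbounded_le I_def using e by (simp add: not_less)
    then obtain r :: "nat \<Rightarrow> nat" where "strict_mono r" "\<forall>n. r n \<in> I"
      using infinite_enumerate by blast
    then have r: "strict_mono r" "\<And>n. e \<le> dist (blinfun_apply g (x (d (r n)))) (blinfun_apply g z)"
      by (auto simp: I_def)
    \<comment> \<open>The cluster point \<open>z'\<close> of this further subsequence agrees with
      \<open>z\<close> under every \<open>\<phi> i\<close>, hence equals \<open>z\<close>; so
      \<open>c\<close> is the value of \<open>g\<close> at \<open>z\<close>, against the gap
      \<open>e\<close>.\<close>
    obtain c s where s: "strict_mono s" "(\<lambda>k. blinfun_apply g (x (d (r (s k))))) \<longlonglongrightarrow> c"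
      using conv_sub[of g "d \<circ> r"] unfolding o_def by blast
    obtain z' where z': "z' \<in> closure V" "\<And>(f :: 'a \<Rightarrow>\<^sub>L real) l. (\<lambda>k. blinfun_apply f (x (d (r (s k))))) \<longlonglongrightarrow> l \<Longrightarrow> blinfun_apply f z' = l"
      using cluster[of "\<lambda>k. d (r (s k))"] by blast
    have "blinfun_apply (\<phi> i) z' = blinfun_apply (\<phi> i) z" for i
    proof -
      obtain l where l: "(\<lambda>k. blinfun_apply (\<phi> i) (x (d k))) \<longlonglongrightarrow> l" using conv by (auto simp: convergent_def)
      then have "(\<lambda>k. blinfun_apply (\<phi> i) (x (d (r (s k))))) \<longlonglongrightarrow> l"
        using LIMSEQ_subseq_LIMSEQ[OF l strict_mono_o[OF r(1) s(1)]] by (simp add: o_def)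
      then show ?thesis using z(2)[OF l] z'(2) by simp
    qed
    then have "z' - z = 0"
      using z(1) z'(1) by (intro separates subspace_diff[OF sub]) (auto simp: blinfun.diff_right)
    then have "c = blinfun_apply g z" using z'(2)[OF s(2)] by simp
    moreover have "(\<lambda>k. dist (blinfun_apply g (x (d (r (s k))))) (blinfun_apply g z)) \<longlonglongrightarrow> dist c (blinfun_apply g z)"
      using s(2) by (intro tendsto_intros)
    then have "e \<le> dist c (blinfun_apply g z)"
      by (rule LIMSEQ_le_const) (use r(2) in auto)
    ultimately show False using \<open>e > 0\<close> by simp
  qed
  then have "weak_conv (x \<circ> d) z" unfolding weak_conv_def by simp
  then show thesis using d that by blast
qed

section \<open>Conjugates of pinning penalties\<close>

text \<open>The Fenchel conjugate of \<open>G\<close> restricted to a dual ball, taken on the space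
  itself. For \<open>G = 0\<close> and \<open>\<rho> > 0\<close> it is
  \<open>\<rho> * norm x\<close>.\<close>

definition cgauge :: "real \<Rightarrow> (('a::real_normed_vector \<Rightarrow>\<^sub>L real) \<Rightarrow> real) \<Rightarrow> 'a \<Rightarrow> real" where
  "cgauge \<rho> G x = (SUP a\<in>cball 0 \<rho>. blinfun_apply a x - G a)"

definition penalty :: "real \<Rightarrow> real \<Rightarrow> (('a::real_normed_vector \<Rightarrow>\<^sub>L real) \<Rightarrow> real) \<Rightarrow> bool" where
  "penalty \<rho> \<eta> G \<longleftrightarrow> (\<forall>a. norm a \<le> \<rho> \<longrightarrow> 0 \<le> G a \<and> G a \<le> \<eta>)"

context
  fixes \<rho> \<eta> :: real and G :: "('a::real_normed_vector \<Rightarrow>\<^sub>L real) \<Rightarrow> real"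
  assumes \<rho>: "0 < \<rho>" and G: "penalty \<rho> \<eta> G"
begin

lemma apply_le_norm: "norm (a :: 'a \<Rightarrow>\<^sub>L real) \<le> \<rho> \<Longrightarrow> \<bar>blinfun_apply a x\<bar> \<le> \<rho> * norm x"
  using norm_blinfun[of a x] mult_right_mono[of "norm a" \<rho> "norm x"] by simp

lemma cgauge_bdd: "bdd_above ((\<lambda>a. blinfun_apply a x - G a) ` cball 0 \<rho>)"
proof (rule bdd_aboveI2)
  fix a :: "'a \<Rightarrow>\<^sub>L real" assume "a \<in> cball 0 \<rho>"
  then show "blinfun_apply a x - G a \<le> \<rho> * norm x"
    using apply_le_norm[of a x] G[unfolded penalty_def, rule_format, of a] by auto
qed

lemma cgauge_upper: "norm a \<le> \<rho> \<Longrightarrow> blinfun_apply a x - G a \<le> cgauge \<rho> G x"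
  unfolding cgauge_def by (rule cSUP_upper[OF _ cgauge_bdd]) simp

lemma cgauge_least: "(\<And>a. norm a \<le> \<rho> \<Longrightarrow> blinfun_apply a x - G a \<le> c) \<Longrightarrow> cgauge \<rho> G x \<le> c"
  unfolding cgauge_def by (rule cSUP_least) (use \<rho> in auto)

lemma cgauge_approx:
  assumes "e > 0" shows "\<exists>a. norm a \<le> \<rho> \<and> cgauge \<rho> G x - e < blinfun_apply a x - G a"
proof (rule ccontr)
  assume "\<not> ?thesis"
  then have "cgauge \<rho> G x \<le> cgauge \<rho> G x - e" by (intro cgauge_least) (auto simp: not_less)
  then show False using assms by simp
qed

lemma cgauge_le: "cgauge \<rho> G x \<le> \<rho> * norm x"
proof (rule cgauge_least)
  fix a :: "'a \<Rightarrow>\<^sub>L real" assume "norm a \<le> \<rho>"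
  then show "blinfun_apply a x - G a \<le> \<rho> * norm x"
    using apply_le_norm[of a x] G[unfolded penalty_def, rule_format, of a] by auto
qed

text \<open>The multiple by \<open>\<rho>\<close> of a functional that norms \<open>x\<close>
  competes in the supremum.\<close>

lemma cgauge_ge: "\<rho> * norm x - \<eta> \<le> cgauge \<rho> G x"
proof -
  obtain \<phi> :: "'a \<Rightarrow>\<^sub>L real" where \<phi>: "norm \<phi> \<le> 1" "blinfun_apply \<phi> x = norm x"
    using norming_functional by blast
  have "norm (\<rho> *\<^sub>R \<phi>) \<le> \<rho>" using \<rho> \<phi>(1) mult_left_mono[of "norm \<phi>" 1 \<rho>] by simp
  then show ?thesis
    using cgauge_upper[of "\<rho> *\<^sub>R \<phi>" x] G[unfolded penalty_def, rule_format, of "\<rho> *\<^sub>R \<phi>"] \<phi>(2)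
    by (simp add: blinfun.scaleR_left)
qed

lemma cgauge_lipschitz: "cgauge \<rho> G x \<le> cgauge \<rho> G y + \<rho> * norm (x - y)"
proof (rule cgauge_least)
  fix a :: "'a \<Rightarrow>\<^sub>L real" assume a: "norm a \<le> \<rho>"
  then show "blinfun_apply a x - G a \<le> cgauge \<rho> G y + \<rho> * norm (x - y)"
    using cgauge_upper[OF a, of y] apply_le_norm[OF a, of "x - y"] by (simp add: blinfun.diff_right)
qed

text \<open>A near-maximiser \<open>a\<close> at \<open>z - y\<close> yields a weakly continuous
  affine minorant of the conjugate.\<close>

lemma cgauge_weak_lsc:
  assumes "weak_conv x z"
  shows "ereal (cgauge \<rho> G (z - y)) \<le> liminf (\<lambda>n. ereal (cgauge \<rho> G (x n - y)))"
proof (rule ereal_le_epsilon2)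
  fix e :: real assume "e > 0"
  then obtain a where a: "norm a \<le> \<rho>" "cgauge \<rho> G (z - y) - e < blinfun_apply a (z - y) - G a"
    using cgauge_approx by blast
  have "(\<lambda>n. blinfun_apply a (x n - y) - G a) \<longlonglongrightarrow> blinfun_apply a (z - y) - G a"
    using assms unfolding weak_conv_def blinfun.diff_right by (intro tendsto_diff) auto
  then have "ereal (blinfun_apply a (z - y) - G a) = liminf (\<lambda>n. ereal (blinfun_apply a (x n - y) - G a))"
    by (intro lim_imp_Liminf[symmetric]) auto
  also have "\<dots> \<le> liminf (\<lambda>n. ereal (cgauge \<rho> G (x n - y)))"
    by (intro Liminf_mono always_eventually) (simp add: cgauge_upper[OF a(1)])
  finally have "ereal (cgauge \<rho> G (z - y) - e) \<le> liminf (\<lambda>n. ereal (cgauge \<rho> G (x n - y)))"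
    using a(2) by (meson ereal_less_eq(3) less_imp_le order_trans)
  then have "ereal (cgauge \<rho> G (z - y) - e) + ereal e \<le> liminf (\<lambda>n. ereal (cgauge \<rho> G (x n - y))) + ereal e"
    by (rule add_right_mono)
  then show "ereal (cgauge \<rho> G (z - y)) \<le> liminf (\<lambda>n. ereal (cgauge \<rho> G (x n - y))) + ereal e" by simp
qed

end

lemma cgauge_compare:
  assumes "0 < \<rho>" "penalty \<rho> \<eta> G" "penalty \<rho> \<eta> H"
    and "\<And>a. norm a \<le> \<rho> \<Longrightarrow> H a \<le> G a + t"
  shows "cgauge \<rho> G x \<le> cgauge \<rho> H x + t"
proof (rule cgauge_least[OF assms(1,2)])
  fix a :: "'a \<Rightarrow>\<^sub>L real" assume a: "norm a \<le> \<rho>"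
  show "blinfun_apply a x - G a \<le> cgauge \<rho> H x + t"
    using cgauge_upper[OF assms(1,3) a, of x] assms(4)[OF a] by simp
qed

text \<open>The weights are such that the \<open>i\<close>-th term of the series is at most \<open>\<eta> / 2 ^ Suc i\<close> on the ball
  of radius \<open>\<rho>\<close>, however large the pin \<open>b\<close> is.\<close>

definition pin_weight :: "real \<Rightarrow> real \<Rightarrow> nat \<Rightarrow> 'a::real_normed_vector \<Rightarrow> real" where
  "pin_weight \<rho> \<eta> i b = \<eta> * (1/2) ^ Suc i / (2 * (1 + \<rho>\<^sup>2) * (1 + (norm b)\<^sup>2))"

text \<open>The partial sums have their own name because the closing-off argument can refer to only
  finitely many pins at a time.\<close>

definition pins :: "real \<Rightarrow> real \<Rightarrow> (nat \<Rightarrow> 'a::real_normed_vector) \<Rightarrow> nat \<Rightarrow> 'a \<Rightarrow> real" where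
  "pins \<rho> \<eta> l n a = (\<Sum>i<n. pin_weight \<rho> \<eta> i (l i) * (norm (a - l i))\<^sup>2)"

definition pins_inf :: "real \<Rightarrow> real \<Rightarrow> (nat \<Rightarrow> 'a::real_normed_vector) \<Rightarrow> 'a \<Rightarrow> real" where
  "pins_inf \<rho> \<eta> l a = (\<Sum>i. pin_weight \<rho> \<eta> i (l i) * (norm (a - l i))\<^sup>2)"

context
  fixes \<rho> \<eta> :: real and l :: "nat \<Rightarrow> 'a::real_normed_vector"
  assumes \<rho>: "0 < \<rho>" and \<eta>: "0 < \<eta>"
begin

lemma pin_weight_pos: "0 < pin_weight \<rho> \<eta> i (b :: 'a)"
proof -
  have "0 < 1 + \<rho>\<^sup>2" "0 < 1 + (norm b)\<^sup>2" by (simp_all add: add_pos_nonneg)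
  then show ?thesis unfolding pin_weight_def using \<eta> by simp
qed

lemma pin_le:
  fixes a b :: 'a
  assumes "norm a \<le> \<rho>"
  shows "pin_weight \<rho> \<eta> i b * (norm (a - b))\<^sup>2 \<le> \<eta> * (1/2) ^ Suc i"
proof -
  have pos: "0 < 1 + \<rho>\<^sup>2" "0 < 1 + (norm b)\<^sup>2" by (simp_all add: add_pos_nonneg)
  have "(norm (a - b))\<^sup>2 \<le> (norm a + norm b)\<^sup>2"
    by (intro power_mono norm_triangle_ineq4) auto
  also have "\<dots> \<le> 2 * (norm a)\<^sup>2 + 2 * (norm b)\<^sup>2"
    using zero_le_power2[of "norm a - norm b"] by (simp add: power2_sum power2_diff)
  also have "\<dots> \<le> 2 * \<rho>\<^sup>2 + 2 * (norm b)\<^sup>2" using assms by (simp add: power_mono)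
  also have "\<dots> \<le> 2 * (1 + \<rho>\<^sup>2) * (1 + (norm b)\<^sup>2)" by (simp add: algebra_simps)
  finally have "(norm (a - b))\<^sup>2 / (2 * (1 + \<rho>\<^sup>2) * (1 + (norm b)\<^sup>2)) \<le> 1"
    using pos by (simp add: divide_le_eq)
  then have "\<eta> * (1/2) ^ Suc i * ((norm (a - b))\<^sup>2 / (2 * (1 + \<rho>\<^sup>2) * (1 + (norm b)\<^sup>2))) \<le> \<eta> * (1/2) ^ Suc i * 1"
    using \<eta> by (intro mult_left_mono) auto
  then show ?thesis unfolding pin_weight_def by simp
qed

lemma pin_nonneg: "0 \<le> pin_weight \<rho> \<eta> i b * (norm (a - b))\<^sup>2" for a b :: 'a
  using less_imp_le[OF pin_weight_pos[of i b]] by simp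

lemma pin_bound_sums: "(\<lambda>i. \<eta> * (1/2) ^ Suc i) sums \<eta>"
  using sums_mult[OF power_half_series, of \<eta>] by simp

lemma pins_summable:
  assumes "norm a \<le> \<rho>"
  shows "summable (\<lambda>i. pin_weight \<rho> \<eta> i (l i) * (norm (a - l i))\<^sup>2)"
  by (rule summable_comparison_test'[OF sums_summable[OF pin_bound_sums], of 0])
    (use pin_le[OF assms] pin_nonneg in auto)

lemma pins_nonneg: "0 \<le> pins \<rho> \<eta> l n a"
  unfolding pins_def by (intro sum_nonneg pin_nonneg)

lemma pins_le_pins_inf:
  assumes "norm a \<le> \<rho>" shows "pins \<rho> \<eta> l n a \<le> pins_inf \<rho> \<eta> l a"
  unfolding pins_def pins_inf_def by (intro sum_le_suminf pins_summable[OF assms] pin_nonneg) auto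

text \<open>The bounds \<open>\<eta> / 2 ^ Suc i\<close> of the terms from index \<open>n\<close> on
  add up to \<open>\<eta> / 2 ^ n\<close>.\<close>

lemma pins_inf_le:
  assumes a: "norm a \<le> \<rho>" shows "pins_inf \<rho> \<eta> l a \<le> pins \<rho> \<eta> l n a + \<eta> * (1/2) ^ n"
proof -
  let ?t = "\<lambda>i. pin_weight \<rho> \<eta> i (l i) * (norm (a - l i))\<^sup>2"
  have "pins_inf \<rho> \<eta> l a = (\<Sum>i. ?t (i + n)) + pins \<rho> \<eta> l n a"
    unfolding pins_def pins_inf_def by (rule suminf_split_initial_segment[OF pins_summable[OF a]])
  moreover have "(\<Sum>i. ?t (i + n)) \<le> \<eta> * (1/2) ^ n"
  proof (rule suminf_le_const)
    show "summable (\<lambda>i. ?t (i + n))" using pins_summable[OF a] by (rule summable_ignore_initial_segment)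
    fix m
    have s: "(\<lambda>i. \<eta> * (1/2) ^ n * (1/2) ^ Suc i) sums (\<eta> * (1/2) ^ n * 1)"
      by (rule sums_mult[OF power_half_series])
    have "(\<Sum>i<m. ?t (i + n)) \<le> (\<Sum>i<m. \<eta> * (1/2) ^ n * (1/2) ^ Suc i)"
    proof (rule sum_mono)
      fix i
      have "?t (i + n) \<le> \<eta> * (1/2) ^ Suc (i + n)" by (rule pin_le[OF a])
      then show "?t (i + n) \<le> \<eta> * (1/2) ^ n * (1/2) ^ Suc i" by (simp add: power_add ac_simps)
    qed
    also have "\<dots> \<le> \<eta> * (1/2) ^ n"
      using sum_le_suminf[OF sums_summable[OF s], of "{..<m}"] \<eta> sums_unique[OF s] by simp
    finally show "(\<Sum>i<m. ?t (i + n)) \<le> \<eta> * (1/2) ^ n" .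
  qed
  ultimately show ?thesis by simp
qed

text \<open>With \<open>s\<close> and \<open>t\<close> the distances of \<open>a\<close> and
  \<open>b\<close> to a pin, the midpoint is at distance at most \<open>(s + t) / 2\<close>, whose
  square falls short of the mean of the squares by \<open>(s - t)^2 / 4\<close>. Each term has such
  a gain; only that of the pin \<open>j\<close> is kept.\<close>

lemma pins_inf_midpoint:
  assumes a: "norm a \<le> \<rho>" and b: "norm b \<le> \<rho>"
  shows "pins_inf \<rho> \<eta> l ((1/2) *\<^sub>R (a + b)) \<le> (pins_inf \<rho> \<eta> l a + pins_inf \<rho> \<eta> l b) / 2
    - pin_weight \<rho> \<eta> j (l j) / 4 * (norm (a - l j) - norm (b - l j))\<^sup>2"
proof -
  let ?w = "\<lambda>i. pin_weight \<rho> \<eta> i (l i)"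
  let ?m = "(1/2) *\<^sub>R (a + b)"
  let ?d = "\<lambda>i. ?w i / 4 * (norm (a - l i) - norm (b - l i))\<^sup>2"
  have m: "norm ?m \<le> \<rho>" using norm_triangle_ineq[of a b] a b by simp
  have pin_mid: "?w i * (norm (?m - l i))\<^sup>2 \<le> ?w i * (norm (a - l i))\<^sup>2 / 2 + ?w i * (norm (b - l i))\<^sup>2 / 2 - ?d i" for i
  proof -
    have "?m - l i = (1/2) *\<^sub>R ((a - l i) + (b - l i))"
      by (simp add: algebra_simps flip: scaleR_add_left)
    then have "norm (?m - l i) \<le> (norm (a - l i) + norm (b - l i)) / 2"
      using norm_triangle_ineq[of "a - l i" "b - l i"] by simp
    then have "(norm (?m - l i))\<^sup>2 \<le> ((norm (a - l i) + norm (b - l i)) / 2)\<^sup>2"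
      by (rule power_mono) simp
    also have "\<dots> = (norm (a - l i))\<^sup>2 / 2 + (norm (b - l i))\<^sup>2 / 2 - (norm (a - l i) - norm (b - l i))\<^sup>2 / 4"
      by (simp add: power2_eq_square field_simps)
    finally have "?w i * (norm (?m - l i))\<^sup>2 \<le> ?w i * ((norm (a - l i))\<^sup>2 / 2 + (norm (b - l i))\<^sup>2 / 2 - (norm (a - l i) - norm (b - l i))\<^sup>2 / 4)"
      using less_imp_le[OF pin_weight_pos[of i "l i"]] by (intro mult_left_mono)
    then show ?thesis by (simp add: algebra_simps)
  qed
  have s1: "(\<lambda>i. ?w i * (norm (a - l i))\<^sup>2 / 2 + ?w i * (norm (b - l i))\<^sup>2 / 2 - (if i = j then ?d i else 0))
      sums (pins_inf \<rho> \<eta> l a / 2 + pins_inf \<rho> \<eta> l b / 2 - ?d j)"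
    unfolding pins_inf_def
    by (intro sums_add sums_diff sums_divide summable_sums pins_summable a b sums_single)
  have s2: "(\<lambda>i. ?w i * (norm (?m - l i))\<^sup>2) sums pins_inf \<rho> \<eta> l ?m"
    unfolding pins_inf_def by (intro summable_sums pins_summable m)
  have "pins_inf \<rho> \<eta> l ?m \<le> pins_inf \<rho> \<eta> l a / 2 + pins_inf \<rho> \<eta> l b / 2 - ?d j"
  proof (rule sums_le[OF _ s2 s1])
    fix i
    have "0 \<le> ?d i" using less_imp_le[OF pin_weight_pos[of i "l i"]] by simp
    then show "?w i * (norm (?m - l i))\<^sup>2 \<le> ?w i * (norm (a - l i))\<^sup>2 / 2 + ?w i * (norm (b - l i))\<^sup>2 / 2 - (if i = j then ?d i else 0)"
      using pin_mid[of i] by (cases "i = j") auto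
  qed
  then show ?thesis by (simp add: add_divide_distrib)
qed

end

lemma penalty_pins_inf:
  fixes l :: "nat \<Rightarrow> 'a::real_normed_vector \<Rightarrow>\<^sub>L real"
  assumes "0 < \<rho>" "0 < \<eta>" shows "penalty \<rho> \<eta> (pins_inf \<rho> \<eta> l)"
  unfolding penalty_def
proof (intro allI impI conjI)
  fix a :: "'a \<Rightarrow>\<^sub>L real" assume a: "norm a \<le> \<rho>"
  \<comment> \<open>For the empty family of pins, the comparison of partial sum and series reads
    \<open>0 \<le> pins_inf\<close> and \<open>pins_inf \<le> \<eta>\<close>.\<close>
  have "pins \<rho> \<eta> l 0 a = 0" by (simp add: pins_def)
  then show "0 \<le> pins_inf \<rho> \<eta> l a" "pins_inf \<rho> \<eta> l a \<le> \<eta>"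
    using pins_le_pins_inf[OF assms a, of l 0] pins_inf_le[OF assms a, of l 0] by simp_all
qed

lemma penalty_pins:
  fixes l :: "nat \<Rightarrow> 'a::real_normed_vector \<Rightarrow>\<^sub>L real"
  assumes "0 < \<rho>" "0 < \<eta>" shows "penalty \<rho> \<eta> (pins \<rho> \<eta> l n)"
  unfolding penalty_def
proof (intro allI impI conjI)
  fix a :: "'a \<Rightarrow>\<^sub>L real" assume a: "norm a \<le> \<rho>"
  show "0 \<le> pins \<rho> \<eta> l n a" by (rule pins_nonneg[OF assms])
  show "pins \<rho> \<eta> l n a \<le> \<eta>"
    using pins_le_pins_inf[OF assms a, of l n] penalty_pins_inf[OF assms, of l] a
    unfolding penalty_def by (meson order_trans)
qed

text \<open>By the midpoint estimate, near-maximisers \<open>a\<close> have \<open>norm (a - l i)\<close> close to \<open>norm (w - l i)\<close>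
  for each \<open>i\<close>; choosing \<open>l i\<close> close to \<open>w\<close>, they are close to \<open>w\<close>.\<close>

lemma cgauge_pins_inf_frechet:
  fixes l :: "nat \<Rightarrow> 'a::real_normed_vector \<Rightarrow>\<^sub>L real"
  assumes \<rho>: "0 < \<rho>" and \<eta>: "0 < \<eta>" and w: "norm w \<le> \<rho>" "w \<in> closure (range l)"
    and max: "cgauge \<rho> (pins_inf \<rho> \<eta> l) z \<le> blinfun_apply w z - pins_inf \<rho> \<eta> l w" and e: "0 < e"
  shows "\<exists>d>0. \<forall>h. norm h < d \<longrightarrow>
    cgauge \<rho> (pins_inf \<rho> \<eta> l) (z + h) \<le> cgauge \<rho> (pins_inf \<rho> \<eta> l) z + blinfun_apply w h + e * norm h"
proof -
  let ?G = "pins_inf \<rho> \<eta> l"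
  let ?K = "cgauge \<rho> ?G"
  note pen = penalty_pins_inf[OF \<rho> \<eta>, of l]
  \<comment> \<open>The distance from \<open>a\<close> to \<open>w\<close> will be at most
    \<open>3 * \<theta> = e / 2\<close>: less than \<open>2 * \<theta>\<close> from \<open>a\<close>
    to the pin, less than \<open>\<theta>\<close> from the pin to \<open>w\<close>.\<close>
  define \<theta> where "\<theta> = e / 6"
  have "\<theta> > 0" using e by (simp add: \<theta>_def)
  obtain b where "b \<in> range l" "dist b w < \<theta>"
    using w(2) \<open>\<theta> > 0\<close> unfolding closure_approachable by blast
  then obtain i where i: "norm (w - l i) < \<theta>" by (auto simp: dist_norm norm_minus_commute)
  define c where "c = pin_weight \<rho> \<eta> i (l i)"
  have "c > 0" unfolding c_def by (rule pin_weight_pos[OF \<rho> \<eta>])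
  \<comment> \<open>A \<open>\<delta>\<close>-maximiser has midpoint gain at most
    \<open>\<delta> / 2\<close>; this value turns that into
    \<open>q \<le> \<theta>^2\<close>.\<close>
  define \<delta> where "\<delta> = c * \<theta>\<^sup>2 / 2"
  have "\<delta> > 0" using \<open>c > 0\<close> \<open>\<theta> > 0\<close> by (simp add: \<delta>_def)
  have near: "norm (a - w) \<le> e / 2" if a: "norm a \<le> \<rho>" "?K z - \<delta> \<le> blinfun_apply a z - ?G a" for a
  proof -
    let ?m = "(1/2) *\<^sub>R (a + w)"
    define q where "q = (norm (a - l i) - norm (w - l i))\<^sup>2"
    have m: "norm ?m \<le> \<rho>" using norm_triangle_ineq[of a w] a w by simp
    have f1: "blinfun_apply ?m z - ?G ?m \<le> ?K z" by (rule cgauge_upper[OF \<rho> pen m])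
    have f2: "blinfun_apply ?m z = (blinfun_apply a z + blinfun_apply w z) / 2"
      by (simp add: blinfun.scaleR_left blinfun.add_left)
    have f3: "?G ?m \<le> (?G a + ?G w) / 2 - c / 4 * q"
      unfolding c_def q_def by (rule pins_inf_midpoint[OF \<rho> \<eta> a(1) w(1)])
    have arith: "s \<le> \<delta> / 2" if "x - g \<le> k" "x = (A + W) / 2" "g \<le> (P + Q) / 2 - s" "k - \<delta> \<le> A - P" "k \<le> W - Q"
      for x g k A W P Q s :: real using that by argo
    have "c / 4 * q \<le> \<delta> / 2" by (rule arith[OF f1 f2 f3 a(2) max])
    then have "c * q \<le> c * \<theta>\<^sup>2" unfolding \<delta>_def by argo
    then have "q \<le> \<theta>\<^sup>2" using \<open>c > 0\<close> by (rule mult_left_le_imp_le)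
    then have "norm (a - l i) - norm (w - l i) \<le> \<theta>"
      unfolding q_def by (rule power2_le_imp_le[OF _ less_imp_le[OF \<open>\<theta> > 0\<close>]])
    moreover have "norm (a - w) \<le> norm (a - l i) + norm (w - l i)"
      using norm_triangle_ineq4[of "a - l i" "w - l i"] by simp
    ultimately show ?thesis using i by (simp add: \<theta>_def)
  qed
  \<comment> \<open>A near-maximiser at \<open>z + h\<close> loses at \<open>z\<close> at most
    \<open>\<rho> * norm h\<close> through \<open>?K\<close>, the same through \<open>a\<close>, and
    the slack \<open>e / 2 * norm h\<close>; for \<open>norm h < d\<close> the total is at most
    \<open>\<delta>\<close>.\<close>
  define d where "d = \<delta> / (2 * \<rho> + e)"
  have "d > 0" using \<open>\<delta> > 0\<close> \<rho> e by (simp add: d_def)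
  moreover have "?K (z + h) \<le> ?K z + blinfun_apply w h + e * norm h" if h: "norm h < d" for h
  proof (cases "h = 0")
    case False
    then have "0 < e / 2 * norm h" using e by simp
    then obtain a where a: "norm a \<le> \<rho>" "?K (z + h) - e / 2 * norm h < blinfun_apply a (z + h) - ?G a"
      using cgauge_approx[OF \<rho> pen] by blast
    have "?K z \<le> ?K (z + h) + \<rho> * norm h"
      using cgauge_lipschitz[OF \<rho> pen, of z "z + h"] by simp
    moreover have "\<bar>blinfun_apply a h\<bar> \<le> \<rho> * norm h" by (rule apply_le_norm[OF \<rho> pen a(1)])
    moreover have "(2 * \<rho> + e) * norm h \<le> \<delta>"
    proof -
      have "0 < 2 * \<rho> + e" using \<rho> e by simp
      then have "norm h * (2 * \<rho> + e) < \<delta>" using h unfolding d_def by (simp only: pos_less_divide_eq)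
      then show ?thesis by (simp only: mult.commute less_imp_le)
    qed
    moreover have "0 \<le> e * norm h" using e by simp
    ultimately have "?K z - \<delta> \<le> blinfun_apply a z - ?G a"
      using a(2) unfolding blinfun.add_right distrib_right by linarith
    then have "norm (a - w) \<le> e / 2" by (rule near[OF a(1)])
    then have "blinfun_apply (a - w) h \<le> e / 2 * norm h"
      using norm_blinfun[of "a - w" h] mult_right_mono[of "norm (a - w)" "e / 2" "norm h"] by simp
    moreover have "blinfun_apply a z - ?G a \<le> ?K z" by (rule cgauge_upper[OF \<rho> pen a(1)])
    ultimately show ?thesis using a(2) unfolding blinfun.add_right blinfun.diff_left by linarith
  qed simp
  ultimately show ?thesis by blast
qed

section \<open>A smooth variational principle\<close>

lemma weak_conv_blinfun_apply:
  fixes a :: "nat \<Rightarrow> 'a::real_normed_vector \<Rightarrow>\<^sub>L real"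
  assumes "weak_conv a w"
  shows "(\<lambda>j. blinfun_apply (a j) x) \<longlonglongrightarrow> blinfun_apply w x"
proof -
  define ev :: "('a \<Rightarrow>\<^sub>L real) \<Rightarrow>\<^sub>L real" where "ev = Blinfun (\<lambda>f. blinfun_apply f x)"
  have ev: "blinfun_apply ev f = blinfun_apply f x" for f
    unfolding ev_def by (subst bounded_linear_Blinfun_apply) (auto intro: bounded_linear_intros)
  have "(\<lambda>j. blinfun_apply ev (a j)) \<longlonglongrightarrow> blinfun_apply ev w"
    using assms unfolding weak_conv_def by blast
  then show ?thesis unfolding ev .
qed

lemma tendsto_imp_weak_conv: "x \<longlonglongrightarrow> z \<Longrightarrow> weak_conv x z"
  unfolding weak_conv_def by (intro allI bounded_linear.tendsto[OF blinfun.bounded_linear_right])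

text \<open>The direct method: a minimising sequence in the ball has a weakly convergent
  subsequence, whose limit stays in the ball.\<close>

lemma weak_min_exists:
  fixes \<psi> :: "'a::real_normed_vector \<Rightarrow> ereal"
  assumes refl: "reflexive_space TYPE('a)" and "0 \<le> R"
    and lsc: "\<And>x z. z \<in> cball c R \<Longrightarrow> weak_conv x z \<Longrightarrow> \<psi> z \<le> liminf (\<lambda>n. \<psi> (x n))"
  shows "\<exists>u\<in>cball c R. \<forall>x\<in>cball c R. \<psi> u \<le> \<psi> x"
proof -
  have "\<psi> ` cball c R \<noteq> {}" using \<open>0 \<le> R\<close> by auto
  then obtain v where v: "\<And>n. v n \<in> \<psi> ` cball c R" "v \<longlonglongrightarrow> Inf (\<psi> ` cball c R)"
    using Inf_as_limit[of "\<psi> ` cball c R"] by blast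
  have "\<forall>n. \<exists>x. x \<in> cball c R \<and> v n = \<psi> x" using v(1) unfolding image_iff by blast
  then obtain x where x: "\<And>n. x n \<in> cball c R" "\<And>n. v n = \<psi> (x n)" by metis
  have xR: "norm (x n - c) \<le> R" for n using x(1)[of n] by (simp add: dist_norm norm_minus_commute)
  have "norm (x n) \<le> R + norm c" for n
    using norm_triangle_ineq[of "x n - c" c] xR[of n] by simp
  then obtain r z where r: "strict_mono r" "weak_conv (x \<circ> r) z"
    using reflexive_weak_compact[OF refl] by blast
  have "norm (z - c) \<le> R" using weak_conv_norm_le[OF r(2)] xR by simp
  then have z: "z \<in> cball c R" by (simp add: dist_norm norm_minus_commute)
  have "(\<lambda>n. \<psi> (x (r n))) \<longlonglongrightarrow> Inf (\<psi> ` cball c R)"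
    using LIMSEQ_subseq_LIMSEQ[OF v(2) r(1)] x(2) by (simp add: o_def)
  then have "liminf (\<lambda>n. \<psi> (x (r n))) = Inf (\<psi> ` cball c R)" by (intro lim_imp_Liminf) auto
  then have "\<psi> z \<le> Inf (\<psi> ` cball c R)" using lsc[OF z r(2)] by (simp add: o_def)
  then show ?thesis using z by (auto simp: le_INF_iff)
qed

text \<open>Neither lower limit is minus infinity, so lower limits may be added without an
  indeterminate sum.\<close>

lemma liminf_add_cgauge:
  fixes \<psi> :: "'a::real_normed_vector \<Rightarrow> ereal"
  assumes "0 < \<rho>" "penalty \<rho> \<eta> G" and wc: "weak_conv x z" and "\<psi> z \<noteq> - \<infinity>"
    and "\<psi> z \<le> liminf (\<lambda>n. \<psi> (x n))"
  shows "\<psi> z + ereal (cgauge \<rho> G (z - y)) \<le> liminf (\<lambda>n. \<psi> (x n) + ereal (cgauge \<rho> G (x n - y)))"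
proof -
  let ?k = "\<lambda>n. ereal (cgauge \<rho> G (x n - y))"
  have k: "ereal (cgauge \<rho> G (z - y)) \<le> liminf ?k"
    by (rule cgauge_weak_lsc[OF assms(1,2) wc])
  have "\<psi> z + ereal (cgauge \<rho> G (z - y)) \<le> liminf (\<lambda>n. \<psi> (x n)) + liminf ?k"
    by (rule add_mono[OF assms(5) k])
  also have "\<dots> \<le> liminf (\<lambda>n. \<psi> (x n) + ?k n)"
  proof (rule ereal_liminf_add_mono)
    have "liminf (\<lambda>n. \<psi> (x n)) \<noteq> - \<infinity>" "liminf ?k \<noteq> - \<infinity>" using k assms(4,5) by auto
    then show "\<not> (liminf (\<lambda>n. \<psi> (x n)) = \<infinity> \<and> liminf ?k = - \<infinity> \<or> liminf (\<lambda>n. \<psi> (x n)) = - \<infinity> \<and> liminf ?k = \<infinity>)"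
      by simp
  qed
  finally show ?thesis .
qed

text \<open>Each square is minorised by its tangent at \<open>norm (w - l i)\<close>, and there the
  norm by a functional that norms \<open>w - l i\<close>; the resulting sum is weakly continuous and
  exact at \<open>w\<close>.\<close>

lemma pins_weak_lsc:
  fixes l :: "nat \<Rightarrow> 'a::real_normed_vector"
  assumes "0 < \<rho>" "0 < \<eta>" and a: "weak_conv a w" and le: "\<And>j. pins \<rho> \<eta> l n (a j) \<le> t j" and t: "t \<longlonglongrightarrow> T"
  shows "pins \<rho> \<eta> l n w \<le> T"
proof -
  have "\<forall>i. \<exists>\<phi> :: 'a \<Rightarrow>\<^sub>L real. norm \<phi> \<le> 1 \<and> blinfun_apply \<phi> (w - l i) = norm (w - l i)"
    using norming_functional by blast
  then obtain \<phi> :: "nat \<Rightarrow> 'a \<Rightarrow>\<^sub>L real" where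
    \<phi>: "\<And>i. norm (\<phi> i) \<le> 1" "\<And>i. blinfun_apply (\<phi> i) (w - l i) = norm (w - l i)" by metis
  define s where "s j = (\<Sum>i<n. pin_weight \<rho> \<eta> i (l i) *
    (2 * norm (w - l i) * blinfun_apply (\<phi> i) (a j - l i) - (norm (w - l i))\<^sup>2))" for j
  have lim: "s \<longlonglongrightarrow> (\<Sum>i<n. pin_weight \<rho> \<eta> i (l i) *
    (2 * norm (w - l i) * blinfun_apply (\<phi> i) (w - l i) - (norm (w - l i))\<^sup>2))"
    unfolding s_def blinfun.diff_right
    by (intro tendsto_sum tendsto_mult tendsto_diff tendsto_const a[unfolded weak_conv_def, rule_format])
  have lim: "s \<longlonglongrightarrow> pins \<rho> \<eta> l n w"
    using lim unfolding pins_def \<phi>(2) by (simp add: power2_eq_square)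
  have "s j \<le> pins \<rho> \<eta> l n (a j)" for j
    unfolding s_def pins_def
  proof (intro sum_mono mult_left_mono)
    fix i
    have "blinfun_apply (\<phi> i) (a j - l i) \<le> norm (a j - l i)"
      using norm_blinfun[of "\<phi> i" "a j - l i"] mult_right_mono[OF \<phi>(1)[of i], of "norm (a j - l i)"] by simp
    then have "norm (w - l i) * blinfun_apply (\<phi> i) (a j - l i) \<le> norm (w - l i) * norm (a j - l i)"
      by (rule mult_left_mono) simp
    moreover have "0 \<le> (norm (w - l i) - norm (a j - l i))\<^sup>2" by simp
    ultimately show "2 * norm (w - l i) * blinfun_apply (\<phi> i) (a j - l i) - (norm (w - l i))\<^sup>2 \<le> (norm (a j - l i))\<^sup>2"
      by (simp add: power2_diff)
    show "0 \<le> pin_weight \<rho> \<eta> i (l i)" by (rule less_imp_le[OF pin_weight_pos[OF assms(1,2)]])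
  qed
  then have "s j \<le> t j" for j using le[of j] by (rule order_trans)
  then show ?thesis by (intro LIMSEQ_le[OF lim t]) simp
qed

lemma pins_nth:
  "pins \<rho> \<eta> (\<lambda>i. map l [0..<n] ! i) n = pins \<rho> \<eta> l n"
  by (rule ext) (simp add: pins_def)

text \<open>A countable set \<open>S\<close> of pairs is closed under rational combinations and contains, for all finite
  lists of pins from \<open>S\<close>, the minimiser of the corresponding perturbed problem and near-maximisers
  for the conjugate at the points of \<open>S\<close>. Enumerating the pins of \<open>S\<close> as \<open>l\<close>, a weak limit \<open>u\<close> of the
  minimisers for initial segments lies in the closure of \<open>S\<close>, hence so does some maximiser \<open>w\<close> for
  the conjugate at \<open>u - y\<close>.\<close>

theorem smooth_variational_principle:
  fixes \<psi> :: "'a::real_normed_vector \<Rightarrow> ereal"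
  assumes refl: "reflexive_space TYPE('a)" and "0 \<le> R"
    and lsc: "\<And>x z. z \<in> cball c R \<Longrightarrow> weak_conv x z \<Longrightarrow> \<psi> z \<le> liminf (\<lambda>n. \<psi> (x n))"
    and fin: "\<And>x. \<psi> x \<noteq> - \<infinity>"
    and \<rho>: "0 < \<rho>" and \<eta>: "0 < \<eta>"
  obtains u w K where "u \<in> cball c R"
    and "\<And>x. x \<in> cball c R \<Longrightarrow> \<psi> u + ereal (K (u - y)) \<le> \<psi> x + ereal (K (x - y))"
    and "\<And>x. \<rho> * norm x - \<eta> \<le> K x" and "\<And>x. K x \<le> \<rho> * norm x"
    and "norm w \<le> \<rho>" and "K (u - y) \<le> blinfun_apply w (u - y)"
    and "\<And>e. 0 < e \<Longrightarrow> \<exists>d>0. \<forall>h. norm h < d \<longrightarrow> K (u - y + h) \<le> K (u - y) + blinfun_apply w h + e * norm h"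
proof -
  let ?B = "cball c R"
  define Gl where "Gl ls = pins \<rho> \<eta> (\<lambda>i. ls ! i) (length ls)" for ls :: "('a \<Rightarrow>\<^sub>L real) list"
  define Kl where "Kl ls = cgauge \<rho> (Gl ls)" for ls
  have penl: "penalty \<rho> \<eta> (Gl ls)" for ls unfolding Gl_def by (rule penalty_pins[OF \<rho> \<eta>])
  have "\<exists>u\<in>?B. \<forall>x\<in>?B. \<psi> u + ereal (Kl ls (u - y)) \<le> \<psi> x + ereal (Kl ls (x - y))" for ls
    by (rule weak_min_exists[OF refl \<open>0 \<le> R\<close>])
      (auto simp: Kl_def intro!: liminf_add_cgauge[OF \<rho> penl] fin lsc)
  then obtain ul where ul: "\<And>ls. ul ls \<in> ?B"
    "\<And>ls x. x \<in> ?B \<Longrightarrow> \<psi> (ul ls) + ereal (Kl ls (ul ls - y)) \<le> \<psi> x + ereal (Kl ls (x - y))"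
    by metis
  have "\<exists>a. norm a \<le> \<rho> \<and> Kl ls v - 1 / real (Suc j) < blinfun_apply a v - Gl ls a" for ls v j
    unfolding Kl_def by (rule cgauge_approx[OF \<rho> penl]) simp
  then obtain al where al: "\<And>ls v j. norm (al ls v j) \<le> \<rho>"
    "\<And>ls v j. Kl ls v - 1 / real (Suc j) < blinfun_apply (al ls v j) v - Gl ls (al ls v j)"
    by metis
  \<comment> \<open>Three operations coded by a tag: the minimiser for the pins in the list;
    rational combinations; a near-maximiser of accuracy index \<open>j\<close> at the first
    component of the head, for the pins in the tail. Pairs let points and functionals generate each
    other; the idle component is 0.\<close>
  define op where "op xs m = (case prod_decode m of (t, j) \<Rightarrow>
      if t = 0 then (ul (map snd xs), 0)
      else if t = 1 then real_of_rat (from_nat j) *\<^sub>R (xs ! 0) + xs ! 1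
      else (0, al (map snd (tl xs)) (fst (hd xs) - y) j))" for xs :: "('a \<times> ('a \<Rightarrow>\<^sub>L real)) list" and m
  obtain S where S: "countable S" "{(0, 0)} \<subseteq> S" "\<And>xs m. xs \<in> lists S \<Longrightarrow> op xs m \<in> S"
    by (rule countable_closing[of "{(0, 0)}" op]) auto
  define V where "V = fst ` S"
  define L where "L = snd ` S"
  have lift: "\<exists>xs. xs \<in> lists S \<and> map snd xs = ls" if "ls \<in> lists L" for ls
    using that unfolding L_def lists_image by auto
  have V_ul: "ul ls \<in> V" if "ls \<in> lists L" for ls
  proof -
    obtain xs where "xs \<in> lists S" "map snd xs = ls" using lift[OF \<open>ls \<in> lists L\<close>] by blast
    then show ?thesis using S(3)[of xs "prod_encode (0, 0)"] by (force simp: op_def V_def)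
  qed
  have L_al: "al ls (v - y) j \<in> L" if "ls \<in> lists L" "v \<in> V" for ls v j
  proof -
    obtain xs where xs: "xs \<in> lists S" "map snd xs = ls" using lift[OF \<open>ls \<in> lists L\<close>] by blast
    obtain p where "p \<in> S" "fst p = v" using \<open>v \<in> V\<close> by (auto simp: V_def)
    then show ?thesis using S(3)[of "p # xs" "prod_encode (2, j)"] xs by (force simp: op_def L_def)
  qed
  have S_comb: "real_of_rat (from_nat j) *\<^sub>R p + q \<in> S" if "p \<in> S" "q \<in> S" for p q j
    using S(3)[of "[p, q]" "prod_encode (1, j)"] that by (simp add: op_def)
  have V: "subspace (closure V)" unfolding V_def
  proof (rule subspace_closure_rat_closed)
    show "fst ` S \<noteq> {}" using S(2) by auto
    fix p q m assume "p \<in> fst ` S" "q \<in> fst ` S"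
    then obtain p' q' where "p' \<in> S" "q' \<in> S" "p = fst p'" "q = fst q'" by auto
    then show "real_of_rat (from_nat m) *\<^sub>R p + q \<in> fst ` S"
      using imageI[OF S_comb[of p' q' m], of fst] by simp
  qed
  have L: "subspace (closure L)" unfolding L_def
  proof (rule subspace_closure_rat_closed)
    show "snd ` S \<noteq> {}" using S(2) by auto
    fix p q m assume "p \<in> snd ` S" "q \<in> snd ` S"
    then obtain p' q' where "p' \<in> S" "q' \<in> S" "p = snd p'" "q = snd q'" by auto
    then show "real_of_rat (from_nat m) *\<^sub>R p + q \<in> snd ` S"
      using imageI[OF S_comb[of p' q' m], of snd] by simp
  qed
  define l where "l = from_nat_into L"
  have "countable L" "L \<noteq> {}" using S(1,2) by (auto simp: L_def)
  then have range_l: "range l = L" unfolding l_def by (simp add: range_from_nat_into)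
  define ls where "ls n = map l [0..<n]" for n
  have ls: "ls n \<in> lists L" for n using range_l by (auto simp: ls_def)
  have Gl_ls: "Gl (ls n) = pins \<rho> \<eta> l n" for n
    unfolding Gl_def ls_def length_map length_upt by (simp add: pins_nth)
  define G where "G = pins_inf \<rho> \<eta> l"
  define K where "K = cgauge \<rho> G"
  have pen: "penalty \<rho> \<eta> G" unfolding G_def by (rule penalty_pins_inf[OF \<rho> \<eta>])
  \<comment> \<open>Conjugation reverses order, so \<open>K\<close> lies below each
    \<open>Kl (ls n)\<close>, and by the tail estimate within \<open>\<eta> / 2 ^ n\<close> of
    it.\<close>
  have K_le: "K x \<le> Kl (ls n) x" for x n
  proof -
    have "K x \<le> Kl (ls n) x + 0"
      unfolding K_def Kl_def
      by (rule cgauge_compare[OF \<rho> pen penl]) (use pins_le_pins_inf[OF \<rho> \<eta>, of _ l n] in \<open>simp add: Gl_ls G_def\<close>)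
    then show ?thesis by simp
  qed
  have K_ge: "Kl (ls n) x \<le> K x + \<eta> * (1/2) ^ n" for x n
    unfolding K_def Kl_def
    by (rule cgauge_compare[OF \<rho> penl pen]) (use pins_inf_le[OF \<rho> \<eta>, of _ l n] in \<open>simp add: Gl_ls G_def\<close>)
  have geo: "(\<lambda>n. \<eta> * (1/2) ^ n) \<longlonglongrightarrow> 0"
    using tendsto_mult[OF tendsto_const[of \<eta>] LIMSEQ_power_zero[of "1/2 :: real"]] by simp
  define un where "un n = ul (ls n)" for n
  have unR: "norm (un n - c) \<le> R" for n
    using ul(1)[of "ls n"] by (simp add: un_def dist_norm norm_minus_commute)
  have "norm (un n) \<le> R + norm c" for n
    using norm_triangle_ineq[of "un n - c" c] unR[of n] by simp
  then obtain r u where r: "strict_mono r" "weak_conv (un \<circ> r) u"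
    using reflexive_weak_compact[OF refl] by blast
  have "norm (u - c) \<le> R" using weak_conv_norm_le[OF r(2)] unR by simp
  then have uB: "u \<in> ?B" by (simp add: dist_norm norm_minus_commute)
  have "un n \<in> closure V" for n
    unfolding un_def by (rule subsetD[OF closure_subset V_ul[OF ls]])
  \<comment> \<open>A closed subspace is weakly closed, so the weak limit \<open>u\<close> can be
    approximated in norm by points of \<open>V\<close>, the only points with near-maximisers in
    \<open>L\<close>.\<close>
  then have uV: "u \<in> closure V" using weak_conv_in_subspace[OF r(2) _ V] by simp
  have min: "\<psi> u + ereal (K (u - y)) \<le> \<psi> x + ereal (K (x - y))" if x: "x \<in> ?B" for x
  proof -
    have "\<psi> u + ereal (K (u - y)) \<le> liminf (\<lambda>n. \<psi> ((un \<circ> r) n) + ereal (K ((un \<circ> r) n - y)))"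
      unfolding K_def by (rule liminf_add_cgauge[OF \<rho> pen r(2) fin lsc[OF uB r(2)]])
    also have "\<dots> \<le> liminf (\<lambda>n. \<psi> x + ereal (K (x - y) + \<eta> * (1/2) ^ r n))"
    proof (rule Liminf_mono, rule always_eventually, rule allI)
      fix n
      have "\<psi> ((un \<circ> r) n) + ereal (K ((un \<circ> r) n - y)) \<le> \<psi> (un (r n)) + ereal (Kl (ls (r n)) (un (r n) - y))"
        using K_le by (intro add_mono) auto
      also have "\<dots> \<le> \<psi> x + ereal (Kl (ls (r n)) (x - y))" unfolding un_def by (rule ul(2)[OF x])
      also have "\<dots> \<le> \<psi> x + ereal (K (x - y) + \<eta> * (1/2) ^ r n)" using K_ge by (intro add_mono) auto
      finally show "\<psi> ((un \<circ> r) n) + ereal (K ((un \<circ> r) n - y)) \<le> \<psi> x + ereal (K (x - y) + \<eta> * (1/2) ^ r n)" .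
    qed
    also have "\<dots> = \<psi> x + ereal (K (x - y))"
    proof (rule lim_imp_Liminf)
      have "(\<lambda>n. K (x - y) + \<eta> * (1/2) ^ r n) \<longlonglongrightarrow> K (x - y) + 0"
        using LIMSEQ_subseq_LIMSEQ[OF geo r(1)] by (intro tendsto_add tendsto_const) (simp add: o_def)
      then show "(\<lambda>n. \<psi> x + ereal (K (x - y) + \<eta> * (1/2) ^ r n)) \<longlonglongrightarrow> \<psi> x + ereal (K (x - y))"
        using fin[of x] by (intro tendsto_add_ereal_general tendsto_const) auto
    qed simp
    finally show ?thesis .
  qed
  define z where "z = u - y"
  have "\<forall>j. \<exists>v\<in>V. dist v u < 1 / real (Suc j)"
    using uV unfolding closure_approachable by simp
  then obtain v where v: "\<And>j. v j \<in> V" "\<And>j. dist (v j) u < 1 / real (Suc j)" by metis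
  define a where "a j = al (ls j) (v j - y) j" for j
  have a_norm: "norm (a j) \<le> \<rho>" for j unfolding a_def by (rule al(1))
  \<comment> \<open>The errors are \<open>1 / Suc j\<close> for near-maximality,
    \<open>\<rho> / Suc j\<close> twice for moving from \<open>v j\<close> to \<open>u\<close> in
    \<open>K\<close> and in \<open>a j\<close>, and the tail \<open>\<eta> / 2 ^ j\<close>.\<close>
  define t where "t j = (2 * \<rho> + 1) / real (Suc j) + \<eta> * (1/2) ^ j" for j
  have a_max: "G (a j) \<le> blinfun_apply (a j) z - K z + t j" for j
  proof -
    have "Kl (ls j) (v j - y) - 1 / real (Suc j) < blinfun_apply (a j) (v j - y) - pins \<rho> \<eta> l j (a j)"
      using al(2)[of "ls j" "v j - y" j] by (simp only: a_def Gl_ls)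
    moreover have "K (v j - y) \<le> Kl (ls j) (v j - y)" by (rule K_le)
    moreover have "K z \<le> K (v j - y) + \<rho> * norm (u - v j)"
      using cgauge_lipschitz[OF \<rho> pen, of z "v j - y"] by (simp add: K_def z_def)
    moreover have "\<bar>blinfun_apply (a j) (v j - u)\<bar> \<le> \<rho> * norm (u - v j)"
      using apply_le_norm[OF \<rho> pen a_norm, of j "v j - u"] by (simp add: norm_minus_commute)
    moreover have "blinfun_apply (a j) (v j - u) = blinfun_apply (a j) (v j - y) - blinfun_apply (a j) z"
      by (simp add: z_def blinfun.diff_right)
    moreover have "G (a j) \<le> pins \<rho> \<eta> l j (a j) + \<eta> * (1/2) ^ j"
      unfolding G_def by (rule pins_inf_le[OF \<rho> \<eta> a_norm])
    moreover have "\<rho> * norm (u - v j) \<le> \<rho> * (1 / real (Suc j))"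
      using v(2)[of j] \<rho> by (intro mult_left_mono) (auto simp: dist_norm norm_minus_commute)
    moreover have "t j = 2 * (\<rho> * (1 / real (Suc j))) + 1 / real (Suc j) + \<eta> * (1/2) ^ j"
      unfolding t_def by (simp add: add_divide_distrib)
    ultimately show ?thesis by linarith
  qed
  have t: "t \<longlonglongrightarrow> 0"
  proof -
    have "(\<lambda>j. (2 * \<rho> + 1) * (1 / real (Suc j)) + \<eta> * (1/2) ^ j) \<longlonglongrightarrow> (2 * \<rho> + 1) * 0 + 0"
      by (intro tendsto_add tendsto_mult tendsto_const geo LIMSEQ_Suc[OF lim_1_over_n])
    then show ?thesis by (simp add: t_def[abs_def])
  qed
  obtain s w where s: "strict_mono s" "weak_conv (a \<circ> s) w"
    by (rule reflexive_weak_compact[OF reflexive_space_dual[OF refl] a_norm])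
  have w_norm: "norm w \<le> \<rho>" using weak_conv_norm_le[OF s(2), of 0 \<rho>] a_norm by simp
  have "a j \<in> closure L" for j
    unfolding a_def by (rule subsetD[OF closure_subset L_al[OF ls v(1)]])
  then have wL: "w \<in> closure (range l)"
    unfolding range_l using weak_conv_in_subspace[OF s(2) _ L] by simp
  \<comment> \<open>The weak limit is taken for each fixed \<open>n\<close>; letting
    \<open>n\<close> grow afterwards recovers the whole series and makes \<open>w\<close> a
    maximiser at \<open>z\<close>.\<close>
  have "pins \<rho> \<eta> l n w \<le> blinfun_apply w z - K z + 0" for n
  proof (rule pins_weak_lsc[OF \<rho> \<eta> s(2)])
    fix j
    show "pins \<rho> \<eta> l n ((a \<circ> s) j) \<le> blinfun_apply (a (s j)) z - K z + t (s j)"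
      using pins_le_pins_inf[OF \<rho> \<eta> a_norm[of "s j"], of l n] a_max[of "s j"] by (simp add: G_def)
  next
    show "(\<lambda>j. blinfun_apply (a (s j)) z - K z + t (s j)) \<longlonglongrightarrow> blinfun_apply w z - K z + 0"
      using weak_conv_blinfun_apply[OF s(2), of z] LIMSEQ_subseq_LIMSEQ[OF t s(1)]
      by (intro tendsto_add tendsto_diff tendsto_const) (simp_all add: o_def)
  qed
  then have "(\<Sum>i<n. pin_weight \<rho> \<eta> i (l i) * (norm (w - l i))\<^sup>2) \<le> blinfun_apply w z - K z" for n
    by (simp add: pins_def)
  then have w_max: "G w \<le> blinfun_apply w z - K z"
    unfolding G_def pins_inf_def by (intro suminf_le_const pins_summable[OF \<rho> \<eta> w_norm])
  show thesis
  proof (rule that[of u K w])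
    show "u \<in> ?B" by (rule uB)
    show "norm w \<le> \<rho>" by (rule w_norm)
    show "\<rho> * norm x - \<eta> \<le> K x" for x unfolding K_def by (rule cgauge_ge[OF \<rho> pen])
    show "K x \<le> \<rho> * norm x" for x unfolding K_def by (rule cgauge_le[OF \<rho> pen])
    show "\<psi> u + ereal (K (u - y)) \<le> \<psi> x + ereal (K (x - y))" if "x \<in> ?B" for x
      by (rule min[OF that])
    show "K (u - y) \<le> blinfun_apply w (u - y)"
      using w_max pen[unfolded penalty_def, rule_format, OF w_norm] by (simp add: z_def)
    show "\<exists>d>0. \<forall>h. norm h < d \<longrightarrow> K (u - y + h) \<le> K (u - y) + blinfun_apply w h + e * norm h" if "0 < e" for e
      unfolding K_def G_def z_def[symmetric]
      by (rule cgauge_pins_inf_frechet[OF \<rho> \<eta> w_norm wL _ that])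
        (use w_max in \<open>simp add: K_def G_def\<close>)
  qed
qed

section \<open>Variational convexity\<close>

lemma eps_subdiff_zeroI:
  fixes f :: "'a::real_normed_vector \<Rightarrow> ereal"
  assumes fin: "\<bar>f u\<bar> \<noteq> \<infinity>"
    and le: "\<And>e. 0 < e \<Longrightarrow> \<exists>d>0. \<forall>x. norm (x - u) < d \<longrightarrow>
      f u + ereal (blinfun_apply a (x - u) - e * norm (x - u)) \<le> f x"
  shows "a \<in> eps_subdiff f 0 u"
proof -
  obtain b where b: "f u = ereal b" using fin by auto
  let ?q = "\<lambda>x. (f x - f u - ereal (blinfun_apply a (x - u))) / ereal (norm (x - u))"
  have "0 \<le> Liminf (at u) ?q"
  proof (rule ereal_le_epsilon2)
    fix e :: real assume "0 < e"
    then obtain d where d: "d > 0" "\<And>x. norm (x - u) < d \<Longrightarrow>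
        f u + ereal (blinfun_apply a (x - u) - e * norm (x - u)) \<le> f x"
      using le by blast
    have "eventually (\<lambda>x. ereal (- e) \<le> ?q x) (at u)"
      unfolding eventually_at
    proof (intro exI conjI ballI impI)
      show "0 < d" by (rule d(1))
      fix x assume x: "x \<noteq> u \<and> dist x u < d"
      then have "norm (x - u) > 0" and *: "f u + ereal (blinfun_apply a (x - u) - e * norm (x - u)) \<le> f x"
        using d(2)[of x] by (simp_all add: dist_norm)
      then show "ereal (- e) \<le> ?q x"
        by (cases "f x") (auto simp: b field_simps)
    qed
    then have "ereal (- e) \<le> Liminf (at u) ?q" by (rule Liminf_bounded)
    then have "ereal (- e) + ereal e \<le> Liminf (at u) ?q + ereal e" by (rule add_right_mono)
    then show "0 \<le> Liminf (at u) ?q + ereal e" by (simp add: zero_ereal_def)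
  qed
  then show ?thesis unfolding eps_subdiff_def using fin by (simp add: zero_ereal_def)
qed

text \<open>Constant sequences serve as witnesses.\<close>

lemma eps_subdiff_zero_subset_lim_subdiff: "eps_subdiff f 0 u \<subseteq> lim_subdiff f u"
proof
  fix a assume "a \<in> eps_subdiff f 0 u"
  then show "a \<in> lim_subdiff f u"
    unfolding lim_subdiff_def weak_star_conv_def
    by (intro CollectI exI[of _ "\<lambda>_. 0"] exI[of _ "\<lambda>_. u"] exI[of _ "\<lambda>_. a"])
      (auto simp: decseq_def)
qed

text \<open>The same \<open>U\<close>, \<open>V\<close> and \<open>\<epsilon>\<close> work: equality
  of the graphs makes \<open>us\<close> a subgradient of \<open>g\<close> at \<open>u\<close>, and
  \<open>f u = g u\<close> with \<open>g \<le> f\<close> on \<open>U\<close> transfers the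
  inequality to \<open>f\<close>.\<close>

lemma var_convex_imp_cond_ii:
  assumes "var_convex f xb xs"
  shows "cond_ii f xb xs"
proof -
  obtain U V g \<epsilon> where UV: "convex U" "convex V" "xb \<in> interior U" "xs \<in> interior V" "\<epsilon> > 0"
    and le: "\<forall>x\<in>U. g x \<le> f x"
    and gph: "{(x, ys). x \<in> sublevel_nbhd f xb U \<epsilon> \<and> ys \<in> V \<and> ys \<in> lim_subdiff f x}
          = {(x, ys). x \<in> U \<and> ys \<in> V \<and> ys \<in> conv_subdiff g x}"
    and eq: "\<forall>x ys. x \<in> U \<and> ys \<in> V \<and> ys \<in> conv_subdiff g x \<longrightarrow> f x = g x"
    using assms unfolding var_convex_def by (elim exE conjE) (rule that)
  have "f u + ereal (blinfun_apply us (x - u)) \<le> f x"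
    if u: "u \<in> sublevel_nbhd f xb U \<epsilon>" "us \<in> V" "us \<in> lim_subdiff f u" and x: "x \<in> U" for u us x
  proof -
    have "(u, us) \<in> {(x, ys). x \<in> U \<and> ys \<in> V \<and> ys \<in> conv_subdiff g x}"
      unfolding gph[symmetric] using u by simp
    then have *: "u \<in> U" "us \<in> conv_subdiff g u" by auto
    then have "g u + ereal (blinfun_apply us (x - u)) \<le> g x" by (simp add: conv_subdiff_def)
    moreover have "f u = g u" using eq * u(2) by blast
    ultimately show ?thesis using le x order_trans by fastforce
  qed
  then show ?thesis unfolding cond_ii_def using UV by blast
qed

text \<open>The variational principle is applied to \<open>f - ys\<close>; at a finite interior
  minimiser the upper expansion of \<open>K\<close> makes \<open>ys - w\<close> a subgradient of
  \<open>f\<close>. That conclusion is conditional because finiteness and interiority are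
  established only where the lemma is applied.\<close>

lemma perturbed_subgradient:
  fixes f :: "'a::real_normed_vector \<Rightarrow> ereal" and ys :: "'a \<Rightarrow>\<^sub>L real"
  assumes refl: "reflexive_space TYPE('a)" and "0 \<le> R"
    and lsc: "\<And>z. z \<in> cball c R \<Longrightarrow> weak_seq_lsc_at f z"
    and fin: "\<And>x. f x \<noteq> - \<infinity>" and \<rho>: "0 < \<rho>" and \<eta>: "0 < \<eta>"
  obtains u w K where "u \<in> cball c R"
    and "\<forall>x\<in>cball c R.
      f u + ereal (K (u - y) - blinfun_apply ys u) \<le> f x + ereal (K (x - y) - blinfun_apply ys x)"
    and "\<forall>x. \<rho> * norm x - \<eta> \<le> K x \<and> K x \<le> \<rho> * norm x"
    and "norm w \<le> \<rho>" and "K (u - y) \<le> blinfun_apply w (u - y)"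
    and "\<bar>f u\<bar> \<noteq> \<infinity> \<and> norm (u - c) < R \<longrightarrow> ys - w \<in> eps_subdiff f 0 u"
proof -
  define \<psi> where "\<psi> x = f x + ereal (- blinfun_apply ys x)" for x
  have \<psi>_fin: "\<psi> x \<noteq> - \<infinity>" for x using fin[of x] by (simp add: \<psi>_def)
  have \<psi>_lsc: "\<psi> z \<le> liminf (\<lambda>n. \<psi> (x n))" if z: "z \<in> cball c R" and wc: "weak_conv x z" for x z
  proof -
    have "(\<lambda>n. ereal (- blinfun_apply ys (x n))) \<longlonglongrightarrow> ereal (- blinfun_apply ys z)"
      using wc unfolding weak_conv_def by (auto intro: tendsto_minus)
    then have lin: "liminf (\<lambda>n. ereal (- blinfun_apply ys (x n))) = ereal (- blinfun_apply ys z)"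
      by (intro lim_imp_Liminf) auto
    have "f z \<le> liminf (\<lambda>n. f (x n))" using lsc[OF z] wc unfolding weak_seq_lsc_at_def by blast
    then have "\<psi> z \<le> liminf (\<lambda>n. f (x n)) + liminf (\<lambda>n. ereal (- blinfun_apply ys (x n)))"
      unfolding \<psi>_def lin by (rule add_right_mono)
    also have "\<dots> \<le> liminf (\<lambda>n. \<psi> (x n))"
      unfolding \<psi>_def by (rule ereal_liminf_add_mono) (simp add: lin)
    finally show ?thesis .
  qed
  obtain u w K where uw: "u \<in> cball c R"
    and min: "\<And>x. x \<in> cball c R \<Longrightarrow> \<psi> u + ereal (K (u - y)) \<le> \<psi> x + ereal (K (x - y))"
    and K: "\<And>x. \<rho> * norm x - \<eta> \<le> K x" "\<And>x. K x \<le> \<rho> * norm x"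
    and w: "norm w \<le> \<rho>" "K (u - y) \<le> blinfun_apply w (u - y)"
    and frechet: "\<And>e. 0 < e \<Longrightarrow> \<exists>d>0. \<forall>h. norm h < d \<longrightarrow> K (u - y + h) \<le> K (u - y) + blinfun_apply w h + e * norm h"
    by (rule smooth_variational_principle[OF refl \<open>0 \<le> R\<close> \<psi>_lsc \<psi>_fin \<rho> \<eta>, where y = y]) (assumption | blast)+
  have \<psi>: "\<psi> x + ereal (K (x - y)) = f x + ereal (K (x - y) - blinfun_apply ys x)" for x
    by (cases "f x") (auto simp: \<psi>_def)
  have min': "f u + ereal (K (u - y) - blinfun_apply ys u) \<le> f x + ereal (K (x - y) - blinfun_apply ys x)"
    if "x \<in> cball c R" for x using min[OF that] unfolding \<psi> .
  have sub: "ys - w \<in> eps_subdiff f 0 u" if fu: "\<bar>f u\<bar> \<noteq> \<infinity>" and uR: "norm (u - c) < R"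
  proof (rule eps_subdiff_zeroI)
    show "\<bar>f u\<bar> \<noteq> \<infinity>" by (rule fu)
    fix e :: real assume "0 < e"
    then obtain d where d: "d > 0" "\<And>h. norm h < d \<Longrightarrow> K (u - y + h) \<le> K (u - y) + blinfun_apply w h + e * norm h"
      using frechet by blast
    have "f u + ereal (blinfun_apply (ys - w) (x - u) - e * norm (x - u)) \<le> f x"
      if x: "norm (x - u) < min d (R - norm (u - c))" for x
    proof -
      have "norm (x - c) \<le> R" using x norm_triangle_ineq[of "x - u" "u - c"] by simp
      then have "x \<in> cball c R" by (simp add: dist_norm norm_minus_commute)
      then have le: "f u + ereal (K (u - y) - blinfun_apply ys u) \<le> f x + ereal (K (x - y) - blinfun_apply ys x)"
        by (rule min')
      have "K (x - y) \<le> K (u - y) + blinfun_apply w (x - u) + e * norm (x - u)"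
        using d(2)[of "x - u"] x by simp
      moreover obtain b where "f u = ereal b" using fu by auto
      ultimately show ?thesis using le fin[of x]
        by (cases "f x") (auto simp: blinfun.diff_left blinfun.diff_right)
    qed
    then show "\<exists>d>0. \<forall>x. norm (x - u) < d \<longrightarrow> f u + ereal (blinfun_apply (ys - w) (x - u) - e * norm (x - u)) \<le> f x"
      using \<open>d > 0\<close> uR by (intro exI[of _ "min d (R - norm (u - c))"]) auto
  qed
  show thesis
  proof (rule that[of u K w])
    show "\<bar>f u\<bar> \<noteq> \<infinity> \<and> norm (u - c) < R \<longrightarrow> ys - w \<in> eps_subdiff f 0 u" using sub by simp
  qed (use uw min' K w in auto)
qed

section \<open>Suprema of affine functions\<close>

definition affine_sup :: "('a::real_normed_vector \<Rightarrow> ereal) \<Rightarrow> ('a \<times> ('a \<Rightarrow>\<^sub>L real)) set \<Rightarrow> 'a \<Rightarrow> ereal" where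
  "affine_sup f T x = (SUP (u, us)\<in>T. f u + ereal (blinfun_apply us (x - u)))"

lemma affine_sup_upper: "(u, us) \<in> T \<Longrightarrow> f u + ereal (blinfun_apply us (x - u)) \<le> affine_sup f T x"
  unfolding affine_sup_def by (rule SUP_upper2[of "(u, us)"]) auto

lemma affine_sup_least:
  "(\<And>u us. (u, us) \<in> T \<Longrightarrow> f u + ereal (blinfun_apply us (x - u)) \<le> b) \<Longrightarrow> affine_sup f T x \<le> b"
  unfolding affine_sup_def by (rule SUP_least) auto

lemma convex_affine_sup:
  assumes fin: "\<And>u us. (u, us) \<in> T \<Longrightarrow> \<bar>f u\<bar> \<noteq> \<infinity>"
  shows "convex_efun (affine_sup f T)"
  unfolding convex_efun_def
proof (intro allI impI)
  fix x y and t :: real assume t: "0 < t \<and> t < 1"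
  let ?g = "affine_sup f T"
  show "?g ((1 - t) *\<^sub>R x + t *\<^sub>R y) \<le> ereal (1 - t) * ?g x + ereal t * ?g y"
  proof (rule affine_sup_least)
    fix u us assume p: "(u, us) \<in> T"
    obtain b where b: "f u = ereal b" using fin[OF p] by auto
    have "(1 - t) *\<^sub>R x + t *\<^sub>R y - u = (1 - t) *\<^sub>R (x - u) + t *\<^sub>R (y - u)" by (simp add: algebra_simps)
    then have lin: "blinfun_apply us ((1 - t) *\<^sub>R x + t *\<^sub>R y - u)
        = (1 - t) * blinfun_apply us (x - u) + t * blinfun_apply us (y - u)"
      by (simp only: blinfun.add_right blinfun.scaleR_right real_scaleR_def)
    have "f u + ereal (blinfun_apply us ((1 - t) *\<^sub>R x + t *\<^sub>R y - u))
        = ereal (1 - t) * (f u + ereal (blinfun_apply us (x - u))) + ereal t * (f u + ereal (blinfun_apply us (y - u)))"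
      unfolding lin by (simp add: b algebra_simps)
    also have "\<dots> \<le> ereal (1 - t) * ?g x + ereal t * ?g y"
      using t by (intro add_mono ereal_mult_left_mono affine_sup_upper p) auto
    finally show "f u + ereal (blinfun_apply us ((1 - t) *\<^sub>R x + t *\<^sub>R y - u)) \<le> ereal (1 - t) * ?g x + ereal t * ?g y" .
  qed
qed

lemma lsc_affine_sup:
  assumes fin: "\<And>u us. (u, us) \<in> T \<Longrightarrow> \<bar>f u\<bar> \<noteq> \<infinity>"
  shows "lsc_fun (affine_sup f T)"
  unfolding lsc_fun_def
proof (intro allI affine_sup_least)
  fix x u us assume p: "(u, us) \<in> T"
  obtain b where b: "f u = ereal b" using fin[OF p] by auto
  show "f u + ereal (blinfun_apply us (x - u)) \<le> Liminf (at x) (affine_sup f T)"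
  \<comment> \<open>In the trivial space \<open>at x\<close> is the bottom filter and the lower
    limit is infinity.\<close>
  proof (cases "at x = bot")
    case False
    have "((\<lambda>z. b + blinfun_apply us (z - u)) \<longlongrightarrow> b + blinfun_apply us (x - u)) (at x)"
      unfolding blinfun.diff_right
      by (intro tendsto_intros bounded_linear.tendsto[OF blinfun.bounded_linear_right])
    then have "ereal (b + blinfun_apply us (x - u)) = Liminf (at x) (\<lambda>z. ereal (b + blinfun_apply us (z - u)))"
      using False by (intro lim_imp_Liminf[symmetric]) auto
    also have "\<dots> \<le> Liminf (at x) (affine_sup f T)"
      using affine_sup_upper[OF p, of f] by (intro Liminf_mono always_eventually) (simp add: b)
    finally show ?thesis by (simp add: b)
  qed simp
qed


section \<open>The implication from (ii) to (i)\<close>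

text \<open>The minorant \<open>g\<close> is built from all pairs over \<open>U\<close> and
  \<open>V\<close>, while variational convexity is shown on smaller balls. Perturbed pairs
  \<open>(u, ys - w)\<close> may leave these balls but remain in \<open>T\<close>, where
  \<open>g\<close> agrees with \<open>f\<close>.\<close>

lemma cond_ii_imp_var_convex:
  fixes f :: "'a::real_normed_vector \<Rightarrow> ereal" and xs :: "'a \<Rightarrow>\<^sub>L real"
  assumes refl: "reflexive_space TYPE('a)" and "0 < r" and lsc: "\<And>x. x \<in> ball xb r \<Longrightarrow> weak_seq_lsc_at f x"
    and fin: "\<And>x. f x \<noteq> - \<infinity>" and xb_fin: "f xb < \<infinity>" and xs_lim: "xs \<in> lim_subdiff f xb"
    and ii: "cond_ii f xb xs"
  shows "var_convex f xb xs"
proof -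
  obtain U V \<epsilon> where UV: "xb \<in> interior U" "xs \<in> interior V" "\<epsilon> > 0"
    and ii': "\<forall>u us. u \<in> sublevel_nbhd f xb U \<epsilon> \<and> us \<in> V \<and> us \<in> lim_subdiff f u \<longrightarrow>
      (\<forall>x\<in>U. f x \<ge> f u + ereal (blinfun_apply us (x - u)))"
    using ii unfolding cond_ii_def by (elim exE conjE) (rule that)
  define T where "T = {(u, us). u \<in> sublevel_nbhd f xb U \<epsilon> \<and> us \<in> V \<and> us \<in> lim_subdiff f u}"
  define g where "g = affine_sup f T"
  obtain a where a: "f xb = ereal a" using fin[of xb] xb_fin by (cases "f xb") auto
  have T_U: "u \<in> U" if "(u, us) \<in> T" for u us using that by (auto simp: T_def sublevel_nbhd_def)
  have T_fin: "\<bar>f u\<bar> \<noteq> \<infinity>" if "(u, us) \<in> T" for u us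
    using that fin[of u] by (auto simp: T_def sublevel_nbhd_def a)
  have T_le: "f u + ereal (blinfun_apply us (x - u)) \<le> f x" if "(u, us) \<in> T" "x \<in> U" for u us x
    using that ii' by (auto simp: T_def)
  have g_le: "g x \<le> f x" if "x \<in> U" for x
    unfolding g_def by (rule affine_sup_least) (use T_le that in blast)
  have g_ge: "f u + ereal (blinfun_apply us (x - u)) \<le> g x" if "(u, us) \<in> T" for u us x
    unfolding g_def by (rule affine_sup_upper[OF that])
  have g_eq: "g u = f u" if "(u, us) \<in> T" for u us
    using g_ge[OF that, of u] g_le[OF T_U[OF that]] by (intro antisym) (simp_all add: zero_ereal_def[symmetric])
  have T_sub: "us \<in> conv_subdiff g u" if "(u, us) \<in> T" for u us
    using g_ge[OF that] T_fin[OF that] g_eq[OF that] by (simp add: conv_subdiff_def)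
  have xbT: "(xb, xs) \<in> T"
    using UV(3) xs_lim subsetD[OF interior_subset UV(1)] subsetD[OF interior_subset UV(2)]
    by (simp add: T_def sublevel_nbhd_def a)
  obtain R0 where R0: "R0 > 0" "ball xb R0 \<subseteq> U" using UV(1) by (meson mem_interior)
  obtain \<rho>0 where \<rho>0: "\<rho>0 > 0" "ball xs \<rho>0 \<subseteq> V" using UV(2) by (meson mem_interior)
  define R where "R = min R0 r / 2"
  \<comment> \<open>For \<open>ys\<close> within \<open>\<rho> / 2\<close> of \<open>xs\<close> and
    \<open>norm w \<le> \<rho>\<close>, the functional \<open>ys - w\<close> stays within
    \<open>2 * \<rho> = \<rho>0\<close> of \<open>xs\<close>, and \<open>C\<close> bounds the norms
    of both \<open>ys\<close> and \<open>ys - w\<close>.\<close>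
  define \<rho> where "\<rho> = \<rho>0 / 2"
  define C where "C = norm xs + 2 * \<rho>"
  \<comment> \<open>The minimiser will lie within \<open>6 * R'\<close> of \<open>xb\<close>, hence
    inside the ball of radius \<open>R\<close>, with a value at most
    \<open>8 * C * R' < \<epsilon>\<close> above \<open>f xb\<close>.\<close>
  define R' where "R' = min (R / 8) (\<epsilon> / (16 * C))"
  have "R > 0" using R0(1) \<open>0 < r\<close> by (simp add: R_def)
  have "\<rho> > 0" using \<rho>0(1) by (simp add: \<rho>_def)
  have "C > 0" using \<open>\<rho> > 0\<close> by (simp add: C_def add_nonneg_pos)
  have "R' > 0" using \<open>R > 0\<close> \<open>C > 0\<close> UV(3) by (simp add: R'_def)
  have R'R: "6 * R' < R" using \<open>R > 0\<close> by (simp add: R'_def)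
  have R'C: "8 * (C * R') < \<epsilon>"
  proof -
    have "R' \<le> \<epsilon> / (16 * C)" by (simp add: R'_def)
    then have "C * R' \<le> \<epsilon> / 16" using \<open>C > 0\<close> by (simp add: field_simps)
    then show ?thesis using UV(3) by simp
  qed
  have RU: "cball xb R \<subseteq> U" using R0 \<open>0 < r\<close> by (auto simp: R_def)
  have lscR: "weak_seq_lsc_at f z" if "z \<in> cball xb R" for z
    by (rule lsc) (use that R0(1) \<open>0 < r\<close> in \<open>auto simp: R_def\<close>)
  have ball_R: "y \<in> cball xb R" if "y \<in> ball xb R'" for y using that R'R \<open>R' > 0\<close> by simp
  have step: "\<exists>u. norm (u - y) \<le> \<eta> / \<rho> \<and> f u \<le> g y + ereal (C * (\<eta> / \<rho>))"
    if y: "y \<in> ball xb R'" and ys: "ys \<in> ball xs (\<rho> / 2)" and sub: "ys \<in> conv_subdiff g y"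
      and \<eta>: "0 < \<eta>" "\<eta> \<le> \<rho> * R'" for y ys \<eta>
  proof -
    obtain u w K where u: "u \<in> cball xb R"
      and min: "\<forall>x\<in>cball xb R.
        f u + ereal (K (u - y) - blinfun_apply ys u) \<le> f x + ereal (K (x - y) - blinfun_apply ys x)"
      and K': "\<forall>x. \<rho> * norm x - \<eta> \<le> K x \<and> K x \<le> \<rho> * norm x"
      and w: "norm w \<le> \<rho>" "K (u - y) \<le> blinfun_apply w (u - y)"
      and usub: "\<bar>f u\<bar> \<noteq> \<infinity> \<and> norm (u - xb) < R \<longrightarrow> ys - w \<in> eps_subdiff f 0 u"
      by (rule perturbed_subgradient[where c = xb and R = R and f = f and y = y and ys = ys,
            OF refl less_imp_le[OF \<open>R > 0\<close>] lscR fin \<open>\<rho> > 0\<close> \<eta>(1)])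
        (assumption, rule that)
    have K: "\<rho> * norm x - \<eta> \<le> K x" "K x \<le> \<rho> * norm x" for x using K' by simp_all
    have xbR: "xb \<in> cball xb R" using \<open>R > 0\<close> by simp
    note min_xb = bspec[OF min xbR]
    obtain b where b: "f u = ereal b"
      using min_xb fin[of u] by (cases "f u") (auto simp: a)
    have uU: "u \<in> U" using u RU by blast
    \<comment> \<open>The value at \<open>u\<close> is squeezed between minimality tested at
      \<open>xb\<close> and the inequality of (ii) for the pair \<open>(xb, xs)\<close>.\<close>
    have up: "b + K (u - y) - blinfun_apply ys (u - xb) \<le> a + K (xb - y)"
      using min_xb by (simp add: a b blinfun.diff_right)
    have low: "a + blinfun_apply xs (u - xb) \<le> b"
      using T_le[OF xbT uU] by (simp add: a b)
    have yxb: "norm (xb - y) < R'" using y by (simp add: dist_norm)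
    have ysxs: "norm (ys - xs) < \<rho> / 2" using ys by (simp add: dist_norm norm_minus_commute)
    have tri: "norm (u - xb) \<le> norm (u - y) + norm (xb - y)"
      using norm_triangle_ineq4[of "u - y" "xb - y"] by simp
    have d1: "blinfun_apply (ys - xs) (u - xb) \<le> \<rho> / 2 * norm (u - xb)"
      using norm_blinfun[of "ys - xs" "u - xb"] mult_right_mono[of "norm (ys - xs)" "\<rho> / 2" "norm (u - xb)"] ysxs
      by simp
    have "K (u - y) \<le> blinfun_apply (ys - xs) (u - xb) + K (xb - y)"
      using up low by (simp add: blinfun.diff_left)
    \<comment> \<open>The radius \<open>\<rho> / 2\<close> for \<open>ys\<close> leaves only half of
      \<open>norm (u - xb)\<close> on the right, which is absorbed and gives the bound
      \<open>6 * R'\<close>.\<close>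
    then have "\<rho> * norm (u - y) \<le> \<rho> / 2 * norm (u - xb) + \<rho> * norm (xb - y) + \<rho> * R'"
      using d1 K(1)[of "u - y"] K(2)[of "xb - y"] \<eta>(2) by linarith
    then have "\<rho> * norm (u - y) \<le> \<rho> * (norm (u - xb) / 2 + norm (xb - y) + R')"
      by (simp add: distrib_left)
    then have "norm (u - y) \<le> norm (u - xb) / 2 + norm (xb - y) + R'"
      using \<open>\<rho> > 0\<close> by (simp only: mult_le_cancel_left_pos)
    then have u6: "norm (u - xb) \<le> 6 * R'" using tri yxb by linarith
    have uR: "norm (u - xb) < R" using u6 R'R by linarith
    have norm_ys: "norm ys \<le> C" using norm_triangle_ineq[of "ys - xs" xs] ysxs \<open>\<rho> > 0\<close> by (simp add: C_def)
    have "b < a + \<epsilon>"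
    proof -
      have "blinfun_apply ys (u - xb) \<le> norm ys * norm (u - xb)" using norm_blinfun[of ys "u - xb"] by simp
      also have "\<dots> \<le> C * (6 * R')" using norm_ys u6 \<open>C > 0\<close> by (intro mult_mono) auto
      finally have "blinfun_apply ys (u - xb) \<le> 6 * (C * R')" by simp
      moreover have "\<rho> * norm (xb - y) \<le> \<rho> * R'" using yxb \<open>\<rho> > 0\<close> by simp
      moreover have "0 \<le> \<rho> * norm (u - y)" using \<open>\<rho> > 0\<close> by simp
      moreover have "\<rho> * R' \<le> C * R'" using \<open>\<rho> > 0\<close> \<open>R' > 0\<close> by (intro mult_right_mono) (auto simp: C_def)
      ultimately show ?thesis
        using up K(2)[of "xb - y"] K(1)[of "u - y"] \<eta>(2) R'C by linarith
    qed
    then have usl: "u \<in> sublevel_nbhd f xb U \<epsilon>" using uU by (simp add: sublevel_nbhd_def a b)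
    have "ys - w \<in> lim_subdiff f u"
      using usub uR subsetD[OF eps_subdiff_zero_subset_lim_subdiff] by (simp add: b)
    moreover have usxs: "norm (ys - w - xs) < 2 * \<rho>"
      using norm_triangle_ineq4[of "ys - xs" w] ysxs w(1) \<open>\<rho> > 0\<close> by (simp add: algebra_simps)
    then have "ys - w \<in> V"
      using \<rho>0(2) by (auto simp: \<rho>_def dist_norm norm_minus_commute subset_iff)
    ultimately have uT: "(u, ys - w) \<in> T" using usl by (simp add: T_def)
    obtain c where c: "g y = ereal c" using sub by (auto simp: conv_subdiff_def)
    \<comment> \<open>Adding \<open>g1\<close> and \<open>g2\<close> is monotonicity of the
      subdifferential of \<open>g\<close> at \<open>u\<close> and \<open>y\<close>; it leaves the
      value of \<open>w\<close> at \<open>u - y\<close> nonpositive.\<close>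
    have g1: "b + blinfun_apply (ys - w) (y - u) \<le> c" using g_ge[OF uT, of y] by (simp add: b c)
    have "g y + ereal (blinfun_apply ys (u - y)) \<le> g u" using sub by (simp add: conv_subdiff_def)
    then have g2: "c + blinfun_apply ys (u - y) \<le> b" using g_le[OF uU] by (simp add: b c g_eq[OF uT])
    have "blinfun_apply w (u - y) \<le> 0"
      using g1 g2 by (simp add: blinfun.diff_left blinfun.diff_right)
    then have "\<rho> * norm (u - y) \<le> \<eta>" using w(2) K(1)[of "u - y"] by linarith
    then have uy: "norm (u - y) \<le> \<eta> / \<rho>" using \<open>\<rho> > 0\<close> by (simp add: field_simps)
    have "norm (ys - w) \<le> C" using norm_triangle_ineq[of "ys - w - xs" xs] usxs by (simp add: C_def)
    then have "norm (ys - w) * norm (y - u) \<le> C * (\<eta> / \<rho>)"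
      using uy \<open>C > 0\<close> by (intro mult_mono) (auto simp: norm_minus_commute)
    then have "b \<le> c + C * (\<eta> / \<rho>)" using g1 norm_blinfun[of "ys - w" "y - u"] by simp
    then show ?thesis using uy by (intro exI[of _ u]) (simp add: b c)
  qed
  have exact: "f y = g y" if y: "y \<in> ball xb R'" and ys: "ys \<in> ball xs (\<rho> / 2)" and sub: "ys \<in> conv_subdiff g y" for y ys
  proof (rule antisym)
    \<comment> \<open>The choice \<open>\<eta> = \<rho> * R' / Suc n\<close> makes the distance
      bound \<open>\<eta> / \<rho>\<close> equal to \<open>R' / Suc n\<close>.\<close>
    have "\<exists>u. norm (u - y) \<le> R' / real (Suc n) \<and> f u \<le> g y + ereal (C * (R' / real (Suc n)))" for n
    proof -
      have pos: "0 < \<rho> * R'" using \<open>\<rho> > 0\<close> \<open>R' > 0\<close> by simp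
      then have "\<rho> * R' / real (Suc n) \<le> \<rho> * R' / 1" by (intro divide_left_mono) auto
      then show ?thesis
        using step[OF y ys sub, of "\<rho> * R' / real (Suc n)"] pos \<open>\<rho> > 0\<close> by simp
    qed
    then obtain u where u: "\<And>n. norm (u n - y) \<le> R' / real (Suc n)"
      "\<And>n. f (u n) \<le> g y + ereal (C * (R' / real (Suc n)))" by metis
    have lim: "(\<lambda>n. R' / real (Suc n)) \<longlonglongrightarrow> 0"
      using tendsto_mult[OF tendsto_const[of R'] LIMSEQ_Suc[OF lim_1_over_n]] by simp
    have "(\<lambda>n. u n - y) \<longlonglongrightarrow> 0"
      by (rule Lim_null_comparison[OF always_eventually lim]) (use u(1) in blast)
    then have "u \<longlonglongrightarrow> y" by (simp add: LIM_zero_iff)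
    then have "f y \<le> liminf (\<lambda>n. f (u n))"
      using lscR[OF ball_R[OF y]] tendsto_imp_weak_conv unfolding weak_seq_lsc_at_def by blast
    also have "\<dots> \<le> liminf (\<lambda>n. g y + ereal (C * (R' / real (Suc n))))"
      by (intro Liminf_mono always_eventually allI u(2))
    also have "\<dots> = g y"
    proof (rule lim_imp_Liminf)
      have "(\<lambda>n. ereal (C * (R' / real (Suc n)))) \<longlonglongrightarrow> ereal (C * 0)"
        by (intro tendsto_ereal tendsto_mult tendsto_const lim)
      then have "(\<lambda>n. g y + ereal (C * (R' / real (Suc n)))) \<longlonglongrightarrow> g y + ereal (C * 0)"
        using sub by (intro tendsto_add_ereal_general tendsto_const) (auto simp: conv_subdiff_def)
      then show "(\<lambda>n. g y + ereal (C * (R' / real (Suc n)))) \<longlonglongrightarrow> g y"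
        by (simp add: zero_ereal_def[symmetric])
    qed simp
    finally show "f y \<le> g y" .
    show "g y \<le> f y" using g_le ball_R[OF y] RU by blast
  qed
  have backward: "y \<in> sublevel_nbhd f xb (ball xb R') \<epsilon> \<and> ys \<in> lim_subdiff f y"
    if y: "y \<in> ball xb R'" and ys: "ys \<in> ball xs (\<rho> / 2)" and sub: "ys \<in> conv_subdiff g y" for y ys
  proof
    have fg: "f y = g y" by (rule exact[OF y ys sub])
    obtain c where c: "g y = ereal c" using sub by (auto simp: conv_subdiff_def)
    have sub': "g y + ereal (blinfun_apply ys (x - y)) \<le> g x" for x using sub by (simp add: conv_subdiff_def)
    \<comment> \<open>Testing the subgradient inequality of \<open>g\<close> at \<open>xb\<close>,
      where \<open>g\<close> equals \<open>f\<close>, keeps \<open>y\<close> in the sublevel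
      neighbourhood.\<close>
    have "c + blinfun_apply ys (xb - y) \<le> a" using sub'[of xb] by (simp add: c g_eq[OF xbT] a)
    moreover have "\<bar>blinfun_apply ys (xb - y)\<bar> \<le> C * R'"
    proof -
      have "norm ys \<le> C"
        using norm_triangle_ineq[of "ys - xs" xs] ys \<open>\<rho> > 0\<close> by (simp add: C_def dist_norm norm_minus_commute)
      then have "norm ys * norm (xb - y) \<le> C * R'"
        using y \<open>C > 0\<close> by (intro mult_mono) (auto simp: dist_norm)
      then show ?thesis using norm_blinfun[of ys "xb - y"] by simp
    qed
    moreover have "0 < C * R'" using \<open>C > 0\<close> \<open>R' > 0\<close> by simp
    ultimately have "c < a + \<epsilon>" using R'C by linarith
    then show "y \<in> sublevel_nbhd f xb (ball xb R') \<epsilon>" using y by (simp add: sublevel_nbhd_def fg c a)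
    \<comment> \<open>Near \<open>y\<close> the function \<open>g\<close> is a minorant of
      \<open>f\<close> that touches it at \<open>y\<close>, so subgradients of \<open>g\<close> are
      Frechet subgradients of \<open>f\<close>.\<close>
    have "ys \<in> eps_subdiff f 0 y"
    proof (rule eps_subdiff_zeroI)
      show "\<bar>f y\<bar> \<noteq> \<infinity>" by (simp add: fg c)
      fix e :: real assume "0 < e"
      obtain d where d: "d > 0" "ball y d \<subseteq> ball xb R'" using y open_ball by (meson open_contains_ball)
      have "f y + ereal (blinfun_apply ys (x - y) - e * norm (x - y)) \<le> f x" if "norm (x - y) < d" for x
      proof -
        have "x \<in> ball xb R'" using d(2) that by (auto simp: dist_norm norm_minus_commute subset_iff)
        then have "g x \<le> f x" using g_le ball_R RU by blast
        moreover have "f y + ereal (blinfun_apply ys (x - y) - e * norm (x - y)) \<le> g y + ereal (blinfun_apply ys (x - y))"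
          using \<open>0 < e\<close> by (simp add: fg c)
        ultimately show ?thesis using sub'[of x] by (meson order_trans)
      qed
      then show "\<exists>d>0. \<forall>x. norm (x - y) < d \<longrightarrow> f y + ereal (blinfun_apply ys (x - y) - e * norm (x - y)) \<le> f x"
        using d(1) by blast
    qed
    then show "ys \<in> lim_subdiff f y" using eps_subdiff_zero_subset_lim_subdiff by blast
  qed
  have forward: "(y, ys) \<in> T"
    if "y \<in> sublevel_nbhd f xb (ball xb R') \<epsilon>" "ys \<in> ball xs (\<rho> / 2)" "ys \<in> lim_subdiff f y" for y ys
  proof -
    have "y \<in> U" using that(1) ball_R RU by (auto simp: sublevel_nbhd_def subset_iff)
    moreover have "ys \<in> V" using that(2) \<rho>0 by (auto simp: \<rho>_def subset_iff)
    ultimately show ?thesis using that by (simp add: T_def sublevel_nbhd_def)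
  qed
  show ?thesis
    unfolding var_convex_def
  proof (intro exI conjI)
    show "convex (ball xb R')" "convex (ball xs (\<rho> / 2))" by (rule convex_ball)+
    show "xb \<in> interior (ball xb R')" "xs \<in> interior (ball xs (\<rho> / 2))"
      using \<open>R' > 0\<close> \<open>\<rho> > 0\<close> by simp_all
    show "\<forall>x. g x \<noteq> - \<infinity>"
    proof
      fix x show "g x \<noteq> - \<infinity>" using g_ge[OF xbT, of x] by (auto simp: a)
    qed
    show "convex_efun g" unfolding g_def by (rule convex_affine_sup) (rule T_fin)
    show "lsc_fun g" unfolding g_def by (rule lsc_affine_sup) (rule T_fin)
    show "\<forall>x\<in>ball xb R'. g x \<le> f x" using g_le ball_R RU by blast
    show "0 < \<epsilon>" by (rule UV(3))
    show "{(x, ys). x \<in> sublevel_nbhd f xb (ball xb R') \<epsilon> \<and> ys \<in> ball xs (\<rho> / 2) \<and> ys \<in> lim_subdiff f x}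
      = {(x, ys). x \<in> ball xb R' \<and> ys \<in> ball xs (\<rho> / 2) \<and> ys \<in> conv_subdiff g x}"
    proof (rule set_eqI, clarify, rule iffI)
      fix y ys
      assume "(y, ys) \<in> {(x, ys). x \<in> sublevel_nbhd f xb (ball xb R') \<epsilon> \<and> ys \<in> ball xs (\<rho> / 2) \<and> ys \<in> lim_subdiff f x}"
      then have "y \<in> sublevel_nbhd f xb (ball xb R') \<epsilon>" "ys \<in> ball xs (\<rho> / 2)" "ys \<in> lim_subdiff f y"
        by simp_all
      then show "(y, ys) \<in> {(x, ys). x \<in> ball xb R' \<and> ys \<in> ball xs (\<rho> / 2) \<and> ys \<in> conv_subdiff g x}"
        using T_sub[OF forward] by (simp add: sublevel_nbhd_def)
    next
      fix y ys
      assume "(y, ys) \<in> {(x, ys). x \<in> ball xb R' \<and> ys \<in> ball xs (\<rho> / 2) \<and> ys \<in> conv_subdiff g x}"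
      then show "(y, ys) \<in> {(x, ys). x \<in> sublevel_nbhd f xb (ball xb R') \<epsilon> \<and> ys \<in> ball xs (\<rho> / 2) \<and> ys \<in> lim_subdiff f x}"
        using backward[of y ys] by simp
    qed
    show "\<forall>x ys. x \<in> ball xb R' \<and> ys \<in> ball xs (\<rho> / 2) \<and> ys \<in> conv_subdiff g x \<longrightarrow> f x = g x"
      using exact by blast
  qed
qed

theorem theorem3p4:
  fixes f :: "'a::banach \<Rightarrow> ereal" and xb :: 'a and xs :: "'a \<Rightarrow>\<^sub>L real"
  assumes "proper_fun f" and "lsc_fun f" and "xb \<in> edom f" and "xs \<in> lim_subdiff f xb"
  shows "(var_convex f xb xs \<longrightarrow> cond_ii f xb xs) \<and>
         ((reflexive_space TYPE('a) \<and> (\<exists>r>0. \<forall>x\<in>ball xb r. weak_seq_lsc_at f x))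
            \<longrightarrow> cond_ii f xb xs \<longrightarrow> var_convex f xb xs)"
proof (intro conjI impI)
  show "cond_ii f xb xs" if "var_convex f xb xs" by (rule var_convex_imp_cond_ii[OF that])
next
  assume "reflexive_space TYPE('a) \<and> (\<exists>r>0. \<forall>x\<in>ball xb r. weak_seq_lsc_at f x)"
    and ii: "cond_ii f xb xs"
  then obtain r where refl: "reflexive_space TYPE('a)" and r: "0 < r"
    and lsc: "\<And>x. x \<in> ball xb r \<Longrightarrow> weak_seq_lsc_at f x" by blast
  have fin: "f x \<noteq> - \<infinity>" for x using assms(1) by (simp add: proper_fun_def)
  have dom: "f xb < \<infinity>" using assms(3) by (simp add: edom_def)
  show "var_convex f xb xs"
    by (rule cond_ii_imp_var_convex[OF refl r lsc fin dom assms(4) ii])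
qed

end
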